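(* Let $f$ (with prior $\pi$) be a joint Bayesian model and $g_1,\dots,g_p$ (with priors $\pi_1,\dots,\pi_p$) be conditional models for iterative imputation, and let $\nu_1^{\mathbf x^{obs}}$ and $\nu_2^{\mathbf x^{obs}}$ be the stationary distributions of the Gibbs chain and of the iterative chain, respectively. Suppose that for some $j\in\{1,\dots,p\}$, some (measurable) sets $A$ and $C$, and some $\varepsilon\in(0,1/2)$, either $$\inf_{\mathbf x_{-j}^{mis}\in C}P_j^g(\mathbf x_j^{mis}\in A\mid\mathbf x_{-j}^{mis},\mathbf x^{obs})>\sup_{\mathbf x_{-j}^{mis}\in C}P^f(\mathbf x_j^{mis}\in A\mid\mathbf x_{-j}^{mis},\mathbf x^{obs})+\varepsilon$$ or $$\sup_{\mathbf x_{-j}^{mis}\in C}P_j^g(\mathbf x_j^{mis}\in A\mid\mathbf x_{-j}^{mis},\mathbf x^{obs})<\inf_{\mathbf x_{-j}^{mis}\in C}P^f(\mathbf x_j^{mis}\in A\mid\mathbf x_{-j}^{mis},\mathbf x^{obs})-\varepsilon,$$ and that $\nu_1^{\mathbf x^{obs}}(\mathbf x_{-j}^{mis}\in C)>q$ for some $q\in(0,1)$. Then there exists a set $B$ such that $$\bigl|\nu_2^{\mathbf x^{obs}}(\mathbf x^{mis}\in B)-\nu_1^{\mathbf x^{obs}}(\mathbf x^{mis}\in B)\bigr|>q\varepsilon/4.$$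
   Context: Data. The data set has $n$ cases and $p$ variables; $\mathbf x=(\mathbf x_1,\dots,\mathbf x_p)$ is the complete data. Each variable $\mathbf x_j$ splits into an observed part $\mathbf x_j^{obs}$ and a missing part $\mathbf x_j^{mis}$; $\mathbf x^{obs}=\{\mathbf x_j^{obs}\}_j$, $\mathbf x^{mis}=\{\mathbf x_j^{mis}\}_j$; a subscript $-j$ means all variables except the $j$-th. The missing data process is assumed ignorable. Gibbs chain. Given a family $f(\mathbf x\mid\theta)$ and a prior $\pi(\theta)$, one iteration consists of steps $j=1,\dots,p$: draw $\theta$ from the posterior $p(\theta\mid\mathbf x_j^{obs},\mathbf x_{-j})$ under $f$ and $\pi$, then draw a new $\mathbf x_j^{mis}$ from $f(\mathbf x_j^{mis}\mid\mathbf x_j^{obs},\mathbf x_{-j},\theta)$, always using current values of the other variables. Iterative chain. Given conditional models $g_j(\mathbf x_j\mid\mathbf x_{-j},\theta_j)$ and priors $\pi_j(\theta_j)$, one iteration consists of steps $j=1,\dots,p$: draw $\theta_j$ from the posterior $p_j(\theta_j\mid\mathbf x_j^{obs},\mathbf x_{-j})$ associated with $g_j$ and $\pi_j$, then draw a new $\mathbf x_j^{mis}$ from $g_j(\mathbf x_j^{mis}\mid\mathbf x_j^{obs},\mathbf x_{-j},\theta_j)$. Both chains live on the space of missing data $\mathbf x^{mis}$ and are assumed to have stationary distributions, denoted $\nu_1^{\mathbf x^{obs}}$ (Gibbs) and $\nu_2^{\mathbf x^{obs}}$ (iterative). Posterior predictive distributions: $$P^f(\mathbf x_j^{mis}\in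 A\mid\mathbf x_{-j}^{mis},\mathbf x^{obs})=\int_A\int f(\mathbf x_j^{mis}\mid\mathbf x_{-j}^{mis},\mathbf x^{obs},\theta)\,p(\theta\mid\mathbf x_{-j}^{mis},\mathbf x^{obs})\,d\theta\,d\mathbf x_j^{mis},$$ $$P_j^g(\mathbf x_j^{mis}\in A\mid\mathbf x_{-j}^{mis},\mathbf x^{obs})=\int_A\int g_j(\mathbf x_j^{mis}\mid\mathbf x_{-j}^{mis},\mathbf x^{obs},\theta_j)\,p_j(\theta_j\mid\mathbf x_{-j}^{mis},\mathbf x^{obs})\,d\theta_j\,d\mathbf x_j^{mis}.$$
   Formalization: The bound is proved for the stationary iterative chain observed right after its j-th step, not at the end of a full iteration; the two agree for j = p, and for j < p the claim as worded can fail when the conditional models are incompatible. *)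

theory Defs
  imports "HOL-Probability.Probability"
begin

text \<open>
  A cell \<^term>\<open>(i, j)\<close> of the data matrix holds the value of variable \<^term>\<open>j\<close> for case \<^term>\<open>i\<close>.
  A block of the data is a function that is extensional on a set of cells.  Variable \<^term>\<open>j\<close> takes
  its values in the measure space \<open>\<mu> j\<close>, whose measure is the one that densities of that variable
  refer to (Lebesgue measure, counting measure, ...).
\<close>

type_synonym cell = "nat \<times> nat"

definition cells :: "nat \<Rightarrow> nat \<Rightarrow> cell set" where
  "cells n p = {1..n} \<times> {1..p}"

definition var_cells :: "cell set \<Rightarrow> nat \<Rightarrow> cell set" where
  "var_cells S j = {c \<in> S. snd c = j}"

definition other_cells :: "cell set \<Rightarrow> nat \<Rightarrow> cell set" where
  "other_cells S j = {c \<in> S. snd c \<noteq> j}"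

definition cell_space :: "(nat \<Rightarrow> 'a measure) \<Rightarrow> cell set \<Rightarrow> (cell \<Rightarrow> 'a) measure" where
  "cell_space \<mu> S = PiM S (\<lambda>c. \<mu> (snd c))"

text \<open>
  Let \<open>Mis\<close> be the set of missing cells and \<open>xobs\<close> the observed data.  \<open>complete Mis xobs j u y\<close> is
  the complete data with missing values \<open>u\<close> in the variables other than \<open>j\<close> and \<open>y\<close> in variable \<open>j\<close>.
\<close>

definition complete :: "cell set \<Rightarrow> (cell \<Rightarrow> 'a) \<Rightarrow> nat \<Rightarrow> (cell \<Rightarrow> 'a) \<Rightarrow> (cell \<Rightarrow> 'a) \<Rightarrow> (cell \<Rightarrow> 'a)"
  where "complete Mis xobs j u y =
    override_on xobs (merge (other_cells Mis j) (var_cells Mis j) (u, y)) Mis"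

text \<open>
  One imputation step for variable \<open>j\<close>.  The parameter space is \<open>T\<close> (its measure is the
  \<open>d\<theta>\<close> of the integrals), \<open>\<pi>\<close> is the prior density, and \<open>h \<theta> x\<close> is the model density at the complete
  data \<open>x\<close>: either a joint density \<open>f(x | \<theta>)\<close> or a conditional density \<open>g(x\<^sub>j | x\<^sub>-\<^sub>j, \<theta>)\<close>.
  Integrating out the missing part of variable \<open>j\<close> gives the density of
  the observed part of \<open>x\<^sub>j\<close> (jointly with, respectively conditionally on, \<open>x\<^sub>-\<^sub>j\<close>), which is the
  likelihood of \<open>\<theta>\<close> used in the step.  In both cases Bayes' rule takes the same form.
\<close>

definition obs_lik ::
  "(nat \<Rightarrow> 'a measure) \<Rightarrow> cell set \<Rightarrow> (cell \<Rightarrow> 'a) \<Rightarrow> ('t \<Rightarrow> (cell \<Rightarrow> 'a) \<Rightarrow> ennreal) \<Rightarrow>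
    nat \<Rightarrow> (cell \<Rightarrow> 'a) \<Rightarrow> 't \<Rightarrow> ennreal" where
  "obs_lik \<mu> Mis xobs h j u \<theta> =
    (\<integral>\<^sup>+ y. h \<theta> (complete Mis xobs j u y) \<partial>cell_space \<mu> (var_cells Mis j))"

definition evidence ::
  "(nat \<Rightarrow> 'a measure) \<Rightarrow> cell set \<Rightarrow> (cell \<Rightarrow> 'a) \<Rightarrow> 't measure \<Rightarrow> ('t \<Rightarrow> ennreal) \<Rightarrow>
    ('t \<Rightarrow> (cell \<Rightarrow> 'a) \<Rightarrow> ennreal) \<Rightarrow> nat \<Rightarrow> (cell \<Rightarrow> 'a) \<Rightarrow> ennreal" where
  "evidence \<mu> Mis xobs T \<pi> h j u = (\<integral>\<^sup>+ \<theta>. \<pi> \<theta> * obs_lik \<mu> Mis xobs h j u \<theta> \<partial>T)"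

definition posterior_density ::
  "(nat \<Rightarrow> 'a measure) \<Rightarrow> cell set \<Rightarrow> (cell \<Rightarrow> 'a) \<Rightarrow> 't measure \<Rightarrow> ('t \<Rightarrow> ennreal) \<Rightarrow>
    ('t \<Rightarrow> (cell \<Rightarrow> 'a) \<Rightarrow> ennreal) \<Rightarrow> nat \<Rightarrow> (cell \<Rightarrow> 'a) \<Rightarrow> 't \<Rightarrow> ennreal" where
  "posterior_density \<mu> Mis xobs T \<pi> h j u \<theta> =
    \<pi> \<theta> * obs_lik \<mu> Mis xobs h j u \<theta> / evidence \<mu> Mis xobs T \<pi> h j u"

definition cond_density ::
  "(nat \<Rightarrow> 'a measure) \<Rightarrow> cell set \<Rightarrow> (cell \<Rightarrow> 'a) \<Rightarrow> ('t \<Rightarrow> (cell \<Rightarrow> 'a) \<Rightarrow> ennreal) \<Rightarrow>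
    nat \<Rightarrow> (cell \<Rightarrow> 'a) \<Rightarrow> 't \<Rightarrow> (cell \<Rightarrow> 'a) \<Rightarrow> ennreal" where
  "cond_density \<mu> Mis xobs h j u \<theta> y =
    h \<theta> (complete Mis xobs j u y) / obs_lik \<mu> Mis xobs h j u \<theta>"

definition post_pred ::
  "(nat \<Rightarrow> 'a measure) \<Rightarrow> cell set \<Rightarrow> (cell \<Rightarrow> 'a) \<Rightarrow> 't measure \<Rightarrow> ('t \<Rightarrow> ennreal) \<Rightarrow>
    ('t \<Rightarrow> (cell \<Rightarrow> 'a) \<Rightarrow> ennreal) \<Rightarrow> nat \<Rightarrow> (cell \<Rightarrow> 'a) \<Rightarrow> (cell \<Rightarrow> 'a) measure" where
  "post_pred \<mu> Mis xobs T \<pi> h j u =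
    density (cell_space \<mu> (var_cells Mis j))
      (\<lambda>y. \<integral>\<^sup>+ \<theta>. cond_density \<mu> Mis xobs h j u \<theta> y * posterior_density \<mu> Mis xobs T \<pi> h j u \<theta> \<partial>T)"

text \<open>
  The posterior of the step is defined for every state of the other variables.
  Improper priors are allowed as long as this holds.
\<close>

definition posterior_exists ::
  "(nat \<Rightarrow> 'a measure) \<Rightarrow> cell set \<Rightarrow> (cell \<Rightarrow> 'a) \<Rightarrow> 't measure \<Rightarrow> ('t \<Rightarrow> ennreal) \<Rightarrow>
    ('t \<Rightarrow> (cell \<Rightarrow> 'a) \<Rightarrow> ennreal) \<Rightarrow> nat \<Rightarrow> bool" where
  "posterior_exists \<mu> Mis xobs T \<pi> h j \<longleftrightarrow>
    (\<forall>u \<in> space (cell_space \<mu> (other_cells Mis j)).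
      0 < evidence \<mu> Mis xobs T \<pi> h j u \<and> evidence \<mu> Mis xobs T \<pi> h j u < \<infinity>)"

text \<open>
  Drawing \<open>\<theta>\<close> from the posterior and then the missing part of variable \<open>j\<close> from the conditional model
  amounts to drawing the latter from the posterior predictive distribution.
\<close>

definition impute_step ::
  "(nat \<Rightarrow> 'a measure) \<Rightarrow> cell set \<Rightarrow> (cell \<Rightarrow> 'a) \<Rightarrow> 't measure \<Rightarrow> ('t \<Rightarrow> ennreal) \<Rightarrow>
    ('t \<Rightarrow> (cell \<Rightarrow> 'a) \<Rightarrow> ennreal) \<Rightarrow> nat \<Rightarrow> (cell \<Rightarrow> 'a) \<Rightarrow> (cell \<Rightarrow> 'a) measure" where
  "impute_step \<mu> Mis xobs T \<pi> h j x =
    (let u = restrict x (other_cells Mis j) in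
      distr (post_pred \<mu> Mis xobs T \<pi> h j u) (cell_space \<mu> Mis)
        (\<lambda>y. merge (other_cells Mis j) (var_cells Mis j) (u, y)))"

definition joint_model ::
  "nat \<Rightarrow> nat \<Rightarrow> (nat \<Rightarrow> 'a measure) \<Rightarrow> 't measure \<Rightarrow> ('t \<Rightarrow> ennreal) \<Rightarrow>
    ('t \<Rightarrow> (cell \<Rightarrow> 'a) \<Rightarrow> ennreal) \<Rightarrow> bool" where
  "joint_model n p \<mu> T \<pi> f \<longleftrightarrow>
    sigma_finite_measure T \<and> \<pi> \<in> borel_measurable T \<and>
    (\<lambda>(\<theta>, x). f \<theta> x) \<in> borel_measurable (T \<Otimes>\<^sub>M cell_space \<mu> (cells n p)) \<and>
    (\<forall>\<theta> \<in> space T. (\<integral>\<^sup>+ x. f \<theta> x \<partial>cell_space \<mu> (cells n p)) = 1)"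

definition conditional_model ::
  "nat \<Rightarrow> nat \<Rightarrow> (nat \<Rightarrow> 'a measure) \<Rightarrow> 't measure \<Rightarrow> ('t \<Rightarrow> ennreal) \<Rightarrow>
    ('t \<Rightarrow> (cell \<Rightarrow> 'a) \<Rightarrow> ennreal) \<Rightarrow> nat \<Rightarrow> bool" where
  "conditional_model n p \<mu> T \<pi> g j \<longleftrightarrow>
    sigma_finite_measure T \<and> \<pi> \<in> borel_measurable T \<and>
    (\<lambda>(\<theta>, x). g \<theta> x) \<in> borel_measurable (T \<Otimes>\<^sub>M cell_space \<mu> (cells n p)) \<and>
    (\<forall>\<theta> \<in> space T. \<forall>w \<in> space (cell_space \<mu> (other_cells (cells n p) j)).
      (\<integral>\<^sup>+ z. g \<theta> (merge (other_cells (cells n p) j) (var_cells (cells n p) j) (w, z))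
        \<partial>cell_space \<mu> (var_cells (cells n p) j)) = 1)"

text \<open>
  \<open>law_after K j \<nu>\<close> is the law of the missing data when steps \<open>1, \<dots>, j\<close> of an iteration that starts
  from the law \<open>\<nu>\<close> have been carried out.  A stationary distribution is invariant under a whole
  iteration; if the conditional models are incompatible, the laws after the individual steps of an
  iteration in stationarity differ from each other, and the one in which \<open>x\<^sub>j\<close> given \<open>x\<^sub>-\<^sub>j\<close>
  follows the predictive distribution of step \<open>j\<close> is \<open>law_after K j \<nu>\<close>.
\<close>

definition law_after :: "(nat \<Rightarrow> 's \<Rightarrow> 's measure) \<Rightarrow> nat \<Rightarrow> 's measure \<Rightarrow> 's measure" where
  "law_after K j \<nu> = foldl (\<lambda>\<rho> i. \<rho> \<bind> K i) \<nu> [1..<Suc j]"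

definition stationary_distribution ::
  "'s measure \<Rightarrow> nat \<Rightarrow> (nat \<Rightarrow> 's \<Rightarrow> 's measure) \<Rightarrow> 's measure \<Rightarrow> bool" where
  "stationary_distribution S p K \<nu> \<longleftrightarrow> prob_space \<nu> \<and> sets \<nu> = sets S \<and> law_after K p \<nu> = \<nu>"

end

theory Submission
  imports Defs
begin

text \<open>
  Step \<open>j\<close> of the iterative chain in stationarity leaves \<open>x\<^sub>j\<close> distributed as \<open>P\<^sub>j\<^sup>g\<close> given \<open>x\<^sub>-\<^sub>j\<close>.  If also
  \<open>\<nu>1\<close> has the conditional law \<open>P\<^sup>f\<close>, then total variation closeness on the cylinder \<open>x\<^sub>-\<^sub>j \<in> C\<close> forces
  a gap on the rectangle \<open>x\<^sub>-\<^sub>j \<in> C, x\<^sub>j \<in> A\<close>.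

  The point is therefore that \<open>\<nu>1\<close>, invariant under a full Gibbs scan, is invariant under every single
  step.  All steps are conditional expectations with respect to one measure \<open>M\<close>, the (possibly
  infinite) measure with density \<open>m(x) = \<integral> \<pi>(\<theta>) f(x | \<theta>) d\<theta>\<close>.  Write the laws along a scan as \<open>h\<^sub>i M\<close>;
  \<open>h\<^sub>i\<close> does not depend on \<open>x\<^sub>i\<close>.  The strictly concave functional \<open>\<integral> h / (1 + h) dM\<close>, which is finite
  even when \<open>M\<close> is not, increases by
  \<open>\<integral> (h\<^sub>i\<^sub>-\<^sub>1 - h\<^sub>i)\<^sup>2 / ((1 + h\<^sub>i\<^sub>-\<^sub>1) (1 + h\<^sub>i)\<^sup>2) dM\<close> in step \<open>i\<close>, and it returns to its
  initial value after the scan.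
\<close>

subsection \<open>Resampling one block of coordinates\<close>

text \<open>An imputation step stripped of its parameter: the coordinates \<open>U\<close> are kept,
  and \<open>V\<close> is redrawn with density \<open>d u\<close> given their value
  \<open>u\<close>. Steps of both chains are instances, so the facts below serve both.\<close>

locale block_update = product_sigma_finite D for D :: "'i \<Rightarrow> 'a measure" +
  fixes U V :: "'i set" and d :: "('i \<Rightarrow> 'a) \<Rightarrow> ('i \<Rightarrow> 'a) \<Rightarrow> ennreal"
  assumes finite_U: "finite U" and finite_V: "finite V" and disjoint: "U \<inter> V = {}"
    and d_measurable: "(\<lambda>(u, y). d u y) \<in> borel_measurable (PiM U D \<Otimes>\<^sub>M PiM V D)"
    and d_mass: "\<And>u. u \<in> space (PiM U D) \<Longrightarrow> (\<integral>\<^sup>+ y. d u y \<partial>PiM V D) = 1"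
begin

definition kernel :: "('i \<Rightarrow> 'a) \<Rightarrow> ('i \<Rightarrow> 'a) measure" where
  "kernel x = distr (density (PiM V D) (d (restrict x U))) (PiM (U \<union> V) D)
    (\<lambda>y. merge U V (restrict x U, y))"

lemma measurable_d [measurable (raw)]:
  assumes "f \<in> N \<rightarrow>\<^sub>M PiM U D" "g \<in> N \<rightarrow>\<^sub>M PiM V D"
  shows "(\<lambda>x. d (f x) (g x)) \<in> borel_measurable N"
  using measurable_compose[OF measurable_Pair[OF assms] d_measurable] by simp

lemma restrict_U [measurable]: "(\<lambda>x. restrict x U) \<in> PiM (U \<union> V) D \<rightarrow>\<^sub>M PiM U D"
  by (rule measurable_restrict_subset) simp

lemma restrict_V [measurable]: "(\<lambda>x. restrict x V) \<in> PiM (U \<union> V) D \<rightarrow>\<^sub>M PiM V D"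
  by (rule measurable_restrict_subset) simp

lemma restrict_U_space: "x \<in> space (PiM (U \<union> V) D) \<Longrightarrow> restrict x U \<in> space (PiM U D)"
  using measurable_space[OF restrict_U] .

lemma restrict_merge_U:
  "u \<in> space (PiM U D) \<Longrightarrow> restrict (merge U V (u, y)) U = u"
  using disjoint by (auto simp: space_PiM PiE_iff extensional_restrict)

lemma restrict_merge_V:
  "y \<in> space (PiM V D) \<Longrightarrow> restrict (merge U V (u, y)) V = y"
  using disjoint by (auto simp: space_PiM PiE_iff extensional_restrict)

lemma nn_integral_kernel:
  assumes x: "x \<in> space (PiM (U \<union> V) D)" and [measurable]: "w \<in> borel_measurable (PiM (U \<union> V) D)"
  shows "(\<integral>\<^sup>+ z. w z \<partial>kernel x) =
    (\<integral>\<^sup>+ y. d (restrict x U) y * w (merge U V (restrict x U, y)) \<partial>PiM V D)"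
proof -
  \<comment> \<open>For fixed \<open>x\<close> the kept block is one point of
    \<open>PiM U D\<close>; as a constant map it makes the sections in \<open>y\<close>
    measurable.\<close>
  note [measurable] = measurable_const[OF restrict_U_space[OF x]]
  show ?thesis
    unfolding kernel_def by (simp add: nn_integral_distr nn_integral_density del: merge_restrict)
qed

lemma sets_kernel [simp, measurable_cong]: "sets (kernel x) = sets (PiM (U \<union> V) D)"
  by (simp add: kernel_def)

lemma emeasure_kernel:
  assumes x: "x \<in> space (PiM (U \<union> V) D)" and B: "B \<in> sets (PiM (U \<union> V) D)"
  shows "emeasure (kernel x) B =
    (\<integral>\<^sup>+ y. d (restrict x U) y * indicator B (merge U V (restrict x U, y)) \<partial>PiM V D)"
  using nn_integral_kernel[OF x, of "indicator B"] B by simp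

lemma prob_space_kernel:
  assumes x: "x \<in> space (PiM (U \<union> V) D)"
  shows "prob_space (kernel x)"
proof (rule prob_spaceI)
  have "emeasure (kernel x) (space (kernel x)) = (\<integral>\<^sup>+ z. 1 \<partial>kernel x)" by simp
  also have "\<dots> = 1"
    using nn_integral_kernel[OF x, of "\<lambda>_. 1"] d_mass[OF restrict_U_space[OF x]] by simp
  finally show "emeasure (kernel x) (space (kernel x)) = 1" .
qed

lemma kernel_measurable: "kernel \<in> PiM (U \<union> V) D \<rightarrow>\<^sub>M subprob_algebra (PiM (U \<union> V) D)"
proof (rule measurable_subprob_algebra)
  interpret V: sigma_finite_measure "PiM V D" by (rule sigma_finite[OF finite_V])
  fix B assume [measurable]: "B \<in> sets (PiM (U \<union> V) D)"
  have "(\<lambda>x. \<integral>\<^sup>+ y. d (restrict x U) y * indicator B (merge U V (restrict x U, y)) \<partial>PiM V D)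
      \<in> borel_measurable (PiM (U \<union> V) D)"
    by measurable
  then show "(\<lambda>x. emeasure (kernel x) B) \<in> borel_measurable (PiM (U \<union> V) D)"
    by (rule measurable_cong[THEN iffD2, rotated]) (simp add: emeasure_kernel)
qed (auto intro!: prob_space_kernel prob_space_imp_subprob_space)

lemma prob_space_block_density:
  assumes u: "u \<in> space (PiM U D)"
  shows "prob_space (density (PiM V D) (d u))"
proof -
  note [measurable] = measurable_const[OF u]
  show ?thesis by (rule prob_spaceI) (simp add: emeasure_density d_mass[OF u] cong: nn_integral_cong)
qed

section \<open>Effect of an update on a probability law\<close>

context
  fixes \<nu> :: "('i \<Rightarrow> 'a) measure"
  assumes prob: "prob_space \<nu>" and sets_\<nu>: "sets \<nu> = sets (PiM (U \<union> V) D)"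
begin

lemma space_\<nu>: "space \<nu> = space (PiM (U \<union> V) D)"
  using sets_\<nu> by (rule sets_eq_imp_space_eq)

lemma kernel_measurable': "kernel \<in> \<nu> \<rightarrow>\<^sub>M subprob_algebra (PiM (U \<union> V) D)"
  using kernel_measurable by (simp add: measurable_cong_sets[OF sets_\<nu> refl])

lemma sets_bind_kernel: "sets (\<nu> \<bind> kernel) = sets (PiM (U \<union> V) D)"
  by (rule sets_bind) (auto simp: prob_space.not_empty[OF prob])

lemma prob_space_bind_kernel: "prob_space (\<nu> \<bind> kernel)"
  by (rule prob_space.prob_space_bind[OF prob _ kernel_measurable'])
    (auto simp: space_\<nu> intro: prob_space_kernel intro!: AE_I2)

lemma nn_integral_bind_kernel:
  assumes w: "w \<in> borel_measurable (PiM (U \<union> V) D)"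
  shows "(\<integral>\<^sup>+ z. w z \<partial>(\<nu> \<bind> kernel)) =
    (\<integral>\<^sup>+ x. (\<integral>\<^sup>+ y. d (restrict x U) y * w (merge U V (restrict x U, y)) \<partial>PiM V D) \<partial>\<nu>)"
  unfolding nn_integral_bind[OF w kernel_measurable']
  by (intro nn_integral_cong) (simp add: nn_integral_kernel w space_\<nu>)

text \<open>An integrand that sees only the kept block is constant in the redrawn one, and
  \<open>d u\<close> has mass one. This is the conditional expectation property on which the cyclic
  argument rests.\<close>

lemma nn_integral_bind_kernel_marginal:
  assumes [measurable]: "w \<in> borel_measurable (PiM U D)"
  shows "(\<integral>\<^sup>+ z. w (restrict z U) \<partial>(\<nu> \<bind> kernel)) = (\<integral>\<^sup>+ x. w (restrict x U) \<partial>\<nu>)"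
proof -
  have "(\<integral>\<^sup>+ y. d (restrict x U) y * w (restrict (merge U V (restrict x U, y)) U) \<partial>PiM V D) =
      w (restrict x U)" if x: "x \<in> space \<nu>" for x
  proof -
    have u: "restrict x U \<in> space (PiM U D)" using x restrict_U_space space_\<nu> by auto
    note [measurable] = measurable_const[OF u]
    show ?thesis
      unfolding restrict_merge_U[OF u] by (simp add: d_mass[OF u] nn_integral_multc)
  qed
  then show ?thesis
    by (subst nn_integral_bind_kernel) (auto intro!: nn_integral_cong)
qed

lemma emeasure_bind_kernel_rectangle:
  assumes [measurable]: "A \<in> sets (PiM V D)" "C \<in> sets (PiM U D)"
  shows "emeasure (\<nu> \<bind> kernel)
      {x \<in> space (PiM (U \<union> V) D). restrict x U \<in> C \<and> restrict x V \<in> A} =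
    (\<integral>\<^sup>+ x. emeasure (density (PiM V D) (d (restrict x U))) A * indicator C (restrict x U) \<partial>\<nu>)"
proof -
  let ?w = "\<lambda>x. indicator A (restrict x V) * indicator C (restrict x U) :: ennreal"
  have "emeasure (\<nu> \<bind> kernel)
      {x \<in> space (PiM (U \<union> V) D). restrict x U \<in> C \<and> restrict x V \<in> A} =
      (\<integral>\<^sup>+ x. indicator {x \<in> space (PiM (U \<union> V) D). restrict x U \<in> C \<and> restrict x V \<in> A} x
        \<partial>(\<nu> \<bind> kernel))"
    by (rule nn_integral_indicator[symmetric]) (simp add: sets_bind_kernel)
  also have "\<dots> = (\<integral>\<^sup>+ x. ?w x \<partial>(\<nu> \<bind> kernel))"
    by (rule nn_integral_cong)
      (auto simp: indicator_def sets_eq_imp_space_eq[OF sets_bind_kernel])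
  also have "\<dots> = (\<integral>\<^sup>+ x. emeasure (density (PiM V D) (d (restrict x U))) A *
      indicator C (restrict x U) \<partial>\<nu>)"
  proof (subst nn_integral_bind_kernel)
    show "?w \<in> borel_measurable (PiM (U \<union> V) D)" by measurable
    have "(\<integral>\<^sup>+ y. d (restrict x U) y * ?w (merge U V (restrict x U, y)) \<partial>PiM V D) =
        emeasure (density (PiM V D) (d (restrict x U))) A * indicator C (restrict x U)"
      if x: "x \<in> space \<nu>" for x
    proof -
      have u: "restrict x U \<in> space (PiM U D)" using x restrict_U_space space_\<nu> by auto
      note [measurable] = measurable_const[OF u]
      have "(\<integral>\<^sup>+ y. d (restrict x U) y * ?w (merge U V (restrict x U, y)) \<partial>PiM V D) =
          (\<integral>\<^sup>+ y. (d (restrict x U) y * indicator A y) * indicator C (restrict x U) \<partial>PiM V D)"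
        by (rule nn_integral_cong)
          (simp only: restrict_merge_U[OF u] restrict_merge_V mult.assoc)
      then show ?thesis by (simp add: nn_integral_multc emeasure_density)
    qed
    then show "(\<integral>\<^sup>+ x. \<integral>\<^sup>+ y. d (restrict x U) y * ?w (merge U V (restrict x U, y)) \<partial>PiM V D \<partial>\<nu>) =
      (\<integral>\<^sup>+ x. emeasure (density (PiM V D) (d (restrict x U))) A * indicator C (restrict x U) \<partial>\<nu>)"
      by (intro nn_integral_cong)
  qed
  finally show ?thesis .
qed

lemma emeasure_bind_kernel_cylinder:
  assumes [measurable]: "C \<in> sets (PiM U D)"
  shows "emeasure (\<nu> \<bind> kernel) {x \<in> space (PiM (U \<union> V) D). restrict x U \<in> C} =
    (\<integral>\<^sup>+ x. indicator C (restrict x U) \<partial>\<nu>)"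
proof -
  have "emeasure (\<nu> \<bind> kernel) {x \<in> space (PiM (U \<union> V) D). restrict x U \<in> C} =
      (\<integral>\<^sup>+ x. indicator {x \<in> space (PiM (U \<union> V) D). restrict x U \<in> C} x \<partial>(\<nu> \<bind> kernel))"
    by (rule nn_integral_indicator[symmetric]) (simp add: sets_bind_kernel)
  also have "\<dots> = (\<integral>\<^sup>+ x. indicator C (restrict x U) \<partial>(\<nu> \<bind> kernel))"
    by (rule nn_integral_cong)
      (auto simp: indicator_def sets_eq_imp_space_eq[OF sets_bind_kernel])
  finally show ?thesis by (simp add: nn_integral_bind_kernel_marginal)
qed

text \<open>Over the kept block, the cylinder is the integral of \<open>indicator C\<close>, and the
  rectangle is that of the same indicator weighted by the conditional probability of
  \<open>A\<close>. A bound uniform on \<open>C\<close> therefore compares the integrands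
  pointwise.\<close>

lemma measure_bind_kernel_rectangle:
  assumes A: "A \<in> sets (PiM V D)" and C: "C \<in> sets (PiM U D)" and "0 \<le> a"
  defines "cylinder \<equiv> {x \<in> space (PiM (U \<union> V) D). restrict x U \<in> C}"
    and "rectangle \<equiv> {x \<in> space (PiM (U \<union> V) D). restrict x U \<in> C \<and> restrict x V \<in> A}"
  shows measure_bind_kernel_rectangle_ge:
      "(\<And>u. u \<in> C \<Longrightarrow> a \<le> measure (density (PiM V D) (d u)) A) \<Longrightarrow>
        a * measure (\<nu> \<bind> kernel) cylinder \<le> measure (\<nu> \<bind> kernel) rectangle"
    and measure_bind_kernel_rectangle_le:
      "(\<And>u. u \<in> C \<Longrightarrow> measure (density (PiM V D) (d u)) A \<le> a) \<Longrightarrow>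
        measure (\<nu> \<bind> kernel) rectangle \<le> a * measure (\<nu> \<bind> kernel) cylinder"
proof -
  interpret \<nu>': prob_space "\<nu> \<bind> kernel" by (rule prob_space_bind_kernel)
  note [measurable] = C
  note [measurable_cong] = sets_\<nu>
  have post: "emeasure (density (PiM V D) (d u)) A = ennreal (measure (density (PiM V D) (d u)) A)"
    if "u \<in> C" for u
  proof -
    interpret prob_space "density (PiM V D) (d u)"
      by (rule prob_space_block_density) (use that sets.sets_into_space[OF C] in auto)
    show ?thesis by (rule emeasure_eq_measure)
  qed
  have cyl: "ennreal (a * measure (\<nu> \<bind> kernel) cylinder) =
      (\<integral>\<^sup>+ x. ennreal a * indicator C (restrict x U) \<partial>\<nu>)"
    using \<open>0 \<le> a\<close> emeasure_bind_kernel_cylinder[OF C]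
    by (simp add: ennreal_mult nn_integral_cmult \<nu>'.emeasure_eq_measure cylinder_def)
  have rect: "ennreal (measure (\<nu> \<bind> kernel) rectangle) =
      (\<integral>\<^sup>+ x. emeasure (density (PiM V D) (d (restrict x U))) A * indicator C (restrict x U) \<partial>\<nu>)"
    using emeasure_bind_kernel_rectangle[OF A C]
    by (simp add: \<nu>'.emeasure_eq_measure rectangle_def)
  show "a * measure (\<nu> \<bind> kernel) cylinder \<le> measure (\<nu> \<bind> kernel) rectangle"
    if "\<And>u. u \<in> C \<Longrightarrow> a \<le> measure (density (PiM V D) (d u)) A"
  proof -
    have "ennreal (a * measure (\<nu> \<bind> kernel) cylinder) \<le> ennreal (measure (\<nu> \<bind> kernel) rectangle)"
      unfolding cyl rect using that
      by (intro nn_integral_mono) (auto simp: indicator_def post intro: ennreal_leI)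
    then show ?thesis by simp
  qed
  show "measure (\<nu> \<bind> kernel) rectangle \<le> a * measure (\<nu> \<bind> kernel) cylinder"
    if "\<And>u. u \<in> C \<Longrightarrow> measure (density (PiM V D) (d u)) A \<le> a"
  proof -
    have "ennreal (measure (\<nu> \<bind> kernel) rectangle) \<le> ennreal (a * measure (\<nu> \<bind> kernel) cylinder)"
      unfolding cyl rect using that
      by (intro nn_integral_mono) (auto simp: indicator_def post intro: ennreal_leI)
    then show ?thesis using \<open>0 \<le> a\<close> by simp
  qed
qed

text \<open>By Fubini almost every \<open>W\<close>-slice of a null set of
  \<open>PiM (W \<union> V) D\<close> is null; \<open>ac\<close> carries this over to
  \<open>\<nu>\<close>, and a block redrawn with a density does not charge a null slice. The density
  may depend on all of \<open>U\<close>, while absolute continuity is assumed on \<open>W\<close>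
  alone.\<close>

lemma absolutely_continuous_bind_kernel:
  assumes W: "W \<subseteq> U"
    and ac: "absolutely_continuous (PiM W D) (distr \<nu> (PiM W D) (\<lambda>x. restrict x W))"
  shows "absolutely_continuous (PiM (W \<union> V) D)
    (distr (\<nu> \<bind> kernel) (PiM (W \<union> V) D) (\<lambda>x. restrict x (W \<union> V)))"
  unfolding absolutely_continuous_def
proof
  interpret V: sigma_finite_measure "PiM V D" by (rule sigma_finite[OF finite_V])
  have rW [measurable]: "(\<lambda>x. restrict x W) \<in> PiM (U \<union> V) D \<rightarrow>\<^sub>M PiM W D"
    by (rule measurable_restrict_subset) (use W in auto)
  have rWV [measurable]: "(\<lambda>x. restrict x (W \<union> V)) \<in> PiM (U \<union> V) D \<rightarrow>\<^sub>M PiM (W \<union> V) D"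
    by (rule measurable_restrict_subset) (use W in auto)
  note [measurable_cong] = sets_\<nu> sets_bind_kernel
  fix N assume N: "N \<in> null_sets (PiM (W \<union> V) D)"
  then have [measurable]: "N \<in> sets (PiM (W \<union> V) D)" by auto
  have "(\<integral>\<^sup>+ x. indicator N x \<partial>PiM (W \<union> V) D) = 0" using N by auto
  then have "(\<integral>\<^sup>+ v. (\<integral>\<^sup>+ y. indicator N (merge W V (v, y)) \<partial>PiM V D) \<partial>PiM W D) = 0"
    using W disjoint finite_U finite_V
    by (subst (asm) product_nn_integral_fold) (auto intro: finite_subset)
  then have "AE v in PiM W D. (\<integral>\<^sup>+ y. indicator N (merge W V (v, y)) \<partial>PiM V D) = 0"
    by (subst (asm) nn_integral_0_iff_AE) auto
  then have "AE v in distr \<nu> (PiM W D) (\<lambda>x. restrict x W).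
      (\<integral>\<^sup>+ y. indicator N (merge W V (v, y)) \<partial>PiM V D) = 0"
    by (rule absolutely_continuous_AE[OF _ ac, rotated]) simp
  then have ae: "AE x in \<nu>. (\<integral>\<^sup>+ y. indicator N (merge W V (restrict x W, y)) \<partial>PiM V D) = 0"
    by (subst (asm) AE_distr_iff) auto
  have "emeasure (distr (\<nu> \<bind> kernel) (PiM (W \<union> V) D) (\<lambda>x. restrict x (W \<union> V))) N =
      (\<integral>\<^sup>+ x. indicator N x \<partial>distr (\<nu> \<bind> kernel) (PiM (W \<union> V) D) (\<lambda>x. restrict x (W \<union> V)))"
    by simp
  also have "\<dots> = (\<integral>\<^sup>+ x. indicator N (restrict x (W \<union> V)) \<partial>(\<nu> \<bind> kernel))"
    by (subst nn_integral_distr) auto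
  also have "\<dots> = (\<integral>\<^sup>+ x. (\<integral>\<^sup>+ y. d (restrict x U) y *
      indicator N (restrict (merge U V (restrict x U, y)) (W \<union> V)) \<partial>PiM V D) \<partial>\<nu>)"
    by (subst nn_integral_bind_kernel) auto
  also have "\<dots> = (\<integral>\<^sup>+ x. 0 \<partial>\<nu>)"
  proof (rule nn_integral_cong_AE)
    show "AE x in \<nu>. (\<integral>\<^sup>+ y. d (restrict x U) y *
      indicator N (restrict (merge U V (restrict x U, y)) (W \<union> V)) \<partial>PiM V D) = 0"
      using ae AE_space
    proof eventually_elim
      fix x assume x: "x \<in> space \<nu>"
        and 0: "(\<integral>\<^sup>+ y. indicator N (merge W V (restrict x W, y)) \<partial>PiM V D) = 0"
      have u: "restrict x U \<in> space (PiM U D)" using x restrict_U_space space_\<nu> by auto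
      have v: "restrict x W \<in> space (PiM W D)" using x measurable_space[OF rW] space_\<nu> by auto
      note [measurable] = measurable_const[OF u] measurable_const[OF v]
      \<comment> \<open>Dropping the coordinates in \<open>U - W\<close> from the updated point
        leaves the old \<open>W\<close>-part joined with the new block, so only the null slice of
        \<open>N\<close> at \<open>restrict x W\<close> matters.\<close>
      have eq: "restrict (merge U V (restrict x U, y)) (W \<union> V) = merge W V (restrict x W, y)" for y
        using W disjoint by (auto simp: merge_def restrict_def fun_eq_iff)
      have "AE y in PiM V D. indicator N (merge W V (restrict x W, y)) = (0::ennreal)"
        using 0 by (subst (asm) nn_integral_0_iff_AE) (auto simp del: merge_restrict)
      then have "(\<integral>\<^sup>+ y. d (restrict x U) y * indicator N (merge W V (restrict x W, y)) \<partial>PiM V D)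
          = (\<integral>\<^sup>+ y. 0 \<partial>PiM V D)"
        by (intro nn_integral_cong_AE) auto
      then show "(\<integral>\<^sup>+ y. d (restrict x U) y *
          indicator N (restrict (merge U V (restrict x U, y)) (W \<union> V)) \<partial>PiM V D) = 0"
        unfolding eq by simp
    qed
  qed
  finally show "N \<in> null_sets (distr (\<nu> \<bind> kernel) (PiM (W \<union> V) D) (\<lambda>x. restrict x (W \<union> V)))"
    by (auto simp: null_sets_def)
qed

text \<open>By \<open>d_eq\<close>, \<open>d\<close> is \<open>m\<close> normalised by
  \<open>e\<close>. If \<open>t\<close> is the density of the \<open>U\<close>-marginal of
  \<open>\<nu>\<close>, the updated law has density \<open>t u * d u y\<close>, that is,
  \<open>t u / e u\<close> times \<open>m\<close>. Relative to the measure with density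
  \<open>m\<close>, only a function of the kept block remains.\<close>

lemma bind_kernel_density:
  assumes ac: "absolutely_continuous (PiM (U \<union> V) D) \<nu>"
    and m [measurable]: "m \<in> borel_measurable (PiM (U \<union> V) D)"
    and e [measurable]: "e \<in> borel_measurable (PiM U D)"
    and e_pos: "\<And>u. u \<in> space (PiM U D) \<Longrightarrow> 0 < e u \<and> e u < \<infinity>"
    and d_eq: "\<And>u. u \<in> space (PiM U D) \<Longrightarrow> AE y in PiM V D. d u y * e u = m (merge U V (u, y))"
  obtains r where "r \<in> borel_measurable (PiM U D)" "\<And>u. 0 \<le> (r u :: real)"
    "\<nu> \<bind> kernel = density (density (PiM (U \<union> V) D) m) (\<lambda>x. ennreal (r (restrict x U)))"
proof -
  interpret U: sigma_finite_measure "PiM U D" by (rule sigma_finite[OF finite_U])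
  interpret V: sigma_finite_measure "PiM V D" by (rule sigma_finite[OF finite_V])
  note [measurable_cong] = sets_\<nu> sets_bind_kernel
  let ?\<rho> = "distr \<nu> (PiM U D) (\<lambda>x. restrict x U)"
  interpret \<rho>: prob_space ?\<rho>
    by (rule prob_space.prob_space_distr[OF prob]) measurable
  have "absolutely_continuous (PiM U D) ?\<rho>"
    unfolding absolutely_continuous_def
  proof
    fix N assume N: "N \<in> null_sets (PiM U D)"
    then have [measurable]: "N \<in> sets (PiM U D)" by auto
    have "AE x in PiM (U \<union> V) D. restrict x U \<notin> N"
    proof (rule AE_I')
      let ?E = "{x \<in> space (PiM (U \<union> V) D). restrict x U \<in> N}"
      have "(\<integral>\<^sup>+ x. indicator N (restrict x U) \<partial>PiM (U \<union> V) D) =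
          (\<integral>\<^sup>+ u. (\<integral>\<^sup>+ y. indicator N (restrict (merge U V (u, y)) U) \<partial>PiM V D) \<partial>PiM U D)"
        using disjoint finite_U finite_V by (subst product_nn_integral_fold) auto
      also have "\<dots> = (\<integral>\<^sup>+ u. indicator N u * emeasure (PiM V D) (space (PiM V D)) \<partial>PiM U D)"
        by (intro nn_integral_cong) (simp only: restrict_merge_U nn_integral_const)
      \<comment> \<open>The \<open>V\<close>-space may have infinite mass; its product with the zero
        mass of \<open>N\<close> is still \<open>0\<close> in \<open>ennreal\<close>.\<close>
      also have "\<dots> = 0"
        using N by (auto simp: nn_integral_multc)
      finally have "(\<integral>\<^sup>+ x. indicator N (restrict x U) \<partial>PiM (U \<union> V) D) = 0" .
      moreover have "(\<integral>\<^sup>+ x. indicator N (restrict x U) \<partial>PiM (U \<union> V) D) =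
          (\<integral>\<^sup>+ x. indicator ?E x \<partial>PiM (U \<union> V) D)"
        by (intro nn_integral_cong) (auto simp: indicator_def)
      ultimately show "?E \<in> null_sets (PiM (U \<union> V) D)" by (auto simp: null_sets_def)
    qed auto
    then have "AE x in \<nu>. restrict x U \<notin> N"
      by (rule absolutely_continuous_AE[OF sets_\<nu> ac])
    then have "AE u in ?\<rho>. u \<notin> N"
      by (subst AE_distr_iff) auto
    then show "N \<in> null_sets ?\<rho>"
      by (subst (asm) AE_iff_null_sets[symmetric]) auto
  qed
  then obtain t where t [measurable]: "t \<in> borel_measurable (PiM U D)" and \<rho>_eq: "density (PiM U D) t = ?\<rho>"
    using U.Radon_Nikodym[of ?\<rho>] by auto
  have "(\<integral>\<^sup>+ u. t u \<partial>PiM U D) = emeasure (density (PiM U D) t) (space (PiM U D))"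
    by (simp add: emeasure_density cong: nn_integral_cong)
  also have "\<dots> = 1" using \<rho>.emeasure_space_1 by (simp add: \<rho>_eq)
  finally have "(\<integral>\<^sup>+ u. t u \<partial>PiM U D) \<noteq> \<infinity>" by simp
  then have t_fin: "AE u in PiM U D. t u \<noteq> \<infinity>"
    by (intro nn_integral_noteq_infinite) auto
  \<comment> \<open>The functional used later needs real densities. On the space, the quotient is
    infinite, and hence sent to \<open>0\<close> by \<open>enn2real\<close>, only where
    \<open>t\<close> is infinite; this is a null set because \<open>t\<close> integrates to
    one.\<close>
  define r where "r u = enn2real (t u / e u)" for u
  have r [measurable]: "r \<in> borel_measurable (PiM U D)" unfolding r_def by measurable
  have r_eq: "ennreal (r u) * e u = t u" if "u \<in> space (PiM U D)" "t u \<noteq> \<infinity>" for u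
  proof -
    have "t u / e u < \<infinity>"
      using that e_pos[of u] by (auto simp: ennreal_divide_eq_top_iff less_top[symmetric])
    then have "ennreal (r u) = t u / e u" by (simp add: r_def)
    then have "ennreal (r u) * e u = t u * e u / e u"
      by (simp add: ennreal_times_divide mult.commute)
    moreover have "e u \<noteq> 0" "e u \<noteq> \<top>" using e_pos[OF that(1)] by auto
    ultimately show ?thesis by (simp add: mult_divide_eq_ennreal)
  qed
  have "\<nu> \<bind> kernel = density (density (PiM (U \<union> V) D) m) (\<lambda>x. ennreal (r (restrict x U)))"
  proof (rule measure_eqI)
    fix B assume "B \<in> sets (\<nu> \<bind> kernel)"
    then have B [measurable]: "B \<in> sets (PiM (U \<union> V) D)" by (simp add: sets_bind_kernel)
    let ?k = "\<lambda>u. \<integral>\<^sup>+ y. d u y * indicator B (merge U V (u, y)) \<partial>PiM V D"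
    have "emeasure (\<nu> \<bind> kernel) B = (\<integral>\<^sup>+ x. indicator B x \<partial>(\<nu> \<bind> kernel))"
      by (simp add: sets_bind_kernel)
    also have "\<dots> = (\<integral>\<^sup>+ x. ?k (restrict x U) \<partial>\<nu>)"
      by (rule nn_integral_bind_kernel) measurable
    also have "\<dots> = (\<integral>\<^sup>+ u. ?k u \<partial>?\<rho>)"
      by (subst nn_integral_distr) auto
    also have "\<dots> = (\<integral>\<^sup>+ u. t u * ?k u \<partial>PiM U D)"
      unfolding \<rho>_eq[symmetric] by (subst nn_integral_density) auto
    also have "\<dots> = (\<integral>\<^sup>+ u. (\<integral>\<^sup>+ y. m (merge U V (u, y)) *
        (ennreal (r (restrict (merge U V (u, y)) U)) * indicator B (merge U V (u, y))) \<partial>PiM V D) \<partial>PiM U D)"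
    proof (rule nn_integral_cong_AE, use t_fin AE_space in eventually_elim)
      fix u assume fin: "t u \<noteq> \<infinity>" and u: "u \<in> space (PiM U D)"
      note [measurable] = measurable_const[OF u]
      have "t u * ?k u = (\<integral>\<^sup>+ y. t u * (d u y * indicator B (merge U V (u, y))) \<partial>PiM V D)"
        by (subst nn_integral_cmult) auto
      also have "\<dots> = (\<integral>\<^sup>+ y. (d u y * e u) * (ennreal (r u) * indicator B (merge U V (u, y))) \<partial>PiM V D)"
        by (simp add: r_eq[OF u fin, symmetric] ac_simps)
      also have "\<dots> = (\<integral>\<^sup>+ y. m (merge U V (u, y)) * (ennreal (r u) * indicator B (merge U V (u, y))) \<partial>PiM V D)"
        using d_eq[OF u] by (intro nn_integral_cong_AE) auto
      finally show "t u * ?k u = (\<integral>\<^sup>+ y. m (merge U V (u, y)) *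
        (ennreal (r (restrict (merge U V (u, y)) U)) * indicator B (merge U V (u, y))) \<partial>PiM V D)"
        by (simp only: restrict_merge_U[OF u])
    qed
    also have "\<dots> = (\<integral>\<^sup>+ x. m x * (ennreal (r (restrict x U)) * indicator B x) \<partial>PiM (U \<union> V) D)"
      using disjoint finite_U finite_V by (subst product_nn_integral_fold) auto
    also have "\<dots> = emeasure (density (density (PiM (U \<union> V) D) m) (\<lambda>x. ennreal (r (restrict x U)))) B"
      by (simp add: emeasure_density nn_integral_density)
    finally show "emeasure (\<nu> \<bind> kernel) B =
      emeasure (density (density (PiM (U \<union> V) D) m) (\<lambda>x. ennreal (r (restrict x U)))) B" .
  qed (simp add: sets_bind_kernel)
  moreover have "0 \<le> r u" for u by (simp add: r_def)
  ultimately show thesis using that r by blast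
qed

end
end

subsection \<open>Cyclic conditional expectations\<close>

text \<open>The function \<open>v / (1 + v)\<close> is strictly concave with derivative
  \<open>1 / (1 + v)\<^sup>2\<close>, so it lies below its tangent at \<open>s x\<close>. Hypothesis
  \<open>eq\<close> makes the linear term integrate to zero, as happens when \<open>s\<close> is a
  conditional expectation of \<open>t\<close>.\<close>

lemma concave_functional_mono:
  fixes s t :: "'a \<Rightarrow> real"
  assumes [measurable]: "s \<in> borel_measurable M" "t \<in> borel_measurable M"
    and nonneg: "\<And>x. 0 \<le> s x" "\<And>x. 0 \<le> t x"
    and prob: "prob_space (density M s)" "prob_space (density M t)"
    and eq: "(\<integral>\<^sup>+ x. ennreal (1 / (1 + s x)\<^sup>2) \<partial>density M t) =
      (\<integral>\<^sup>+ x. ennreal (1 / (1 + s x)\<^sup>2) \<partial>density M s)"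
  shows "(\<integral>x. t x / (1 + t x) \<partial>M) \<le> (\<integral>x. s x / (1 + s x) \<partial>M)"
    and "(\<integral>x. t x / (1 + t x) \<partial>M) = (\<integral>x. s x / (1 + s x) \<partial>M) \<Longrightarrow> AE x in M. s x = t x"
proof -
  have int: "integrable M f" if "prob_space (density M f)" "\<And>x. 0 \<le> f x" "f \<in> borel_measurable M"
    for f :: "'a \<Rightarrow> real"
  proof -
    have "(\<integral>\<^sup>+ x. ennreal (f x) \<partial>M) = emeasure (density M f) (space (density M f))"
      using that(3) by (simp add: emeasure_density cong: nn_integral_cong)
    also have "\<dots> = 1" by (rule prob_space.emeasure_space_1[OF that(1)])
    finally show ?thesis
      by (intro integrableI_nonneg) (use that(2,3) in auto)
  qed
  note int_s = int[OF prob(1) nonneg(1)] and int_t = int[OF prob(2) nonneg(2)]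
  have sq: "1 \<le> (1 + s x)\<^sup>2" for x using nonneg(1)[of x] by (simp add: power2_eq_square algebra_simps)
  have quot_le: "v / c \<le> v" if "0 \<le> v" "1 \<le> c" for v c :: real
    using divide_left_mono[of 1 c v] that by simp
  \<comment> \<open>Each of the four quotients is dominated by \<open>s\<close> or \<open>t\<close>,
    which are integrable as probability densities, so an infinite \<open>M\<close> is covered
    too.\<close>
  have i1: "integrable M (\<lambda>x. s x / (1 + s x))"
    by (rule Bochner_Integration.integrable_bound[OF int_s]) (use nonneg in \<open>auto intro!: quot_le\<close>)
  have i2: "integrable M (\<lambda>x. t x / (1 + t x))"
    by (rule Bochner_Integration.integrable_bound[OF int_t]) (use nonneg in \<open>auto intro!: quot_le\<close>)
  have i3: "integrable M (\<lambda>x. s x / (1 + s x)\<^sup>2)"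
    by (rule Bochner_Integration.integrable_bound[OF int_s]) (use nonneg sq in \<open>auto intro!: quot_le\<close>)
  have i4: "integrable M (\<lambda>x. t x / (1 + s x)\<^sup>2)"
    by (rule Bochner_Integration.integrable_bound[OF int_t]) (use nonneg sq in \<open>auto intro!: quot_le\<close>)
  have "(\<integral>x. 1 / (1 + s x)\<^sup>2 \<partial>density M t) = (\<integral>x. 1 / (1 + s x)\<^sup>2 \<partial>density M s)"
    by (simp add: integral_eq_nn_integral eq)
  then have cross: "(\<integral>x. t x / (1 + s x)\<^sup>2 \<partial>M) = (\<integral>x. s x / (1 + s x)\<^sup>2 \<partial>M)"
    using nonneg by (simp add: integral_density)
  \<comment> \<open>\<open>?G\<close> is the exact distance of \<open>t / (1 + t)\<close> below the
    tangent at \<open>s\<close>; it vanishes only where \<open>s\<close> and \<open>t\<close>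
    agree.\<close>
  let ?G = "\<lambda>x. (t x - s x)\<^sup>2 / ((1 + t x) * (1 + s x)\<^sup>2)"
  have G: "?G x = s x / (1 + s x) - t x / (1 + t x) + (t x / (1 + s x)\<^sup>2 - s x / (1 + s x)\<^sup>2)" for x
  proof -
    have "1 + s x \<noteq> 0" "1 + t x \<noteq> 0" using nonneg[of x] by linarith+
    then show ?thesis by (simp add: divide_simps) (simp add: power2_eq_square algebra_simps)
  qed
  have int_G: "integrable M ?G" unfolding G using i1 i2 i3 i4 by auto
  have "(\<integral>x. ?G x \<partial>M) = (\<integral>x. s x / (1 + s x) \<partial>M) - (\<integral>x. t x / (1 + t x) \<partial>M)"
    unfolding G using i1 i2 i3 i4 by (simp add: cross)
  moreover have G_nonneg: "0 \<le> ?G x" for x using nonneg[of x] by auto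
  ultimately show "(\<integral>x. t x / (1 + t x) \<partial>M) \<le> (\<integral>x. s x / (1 + s x) \<partial>M)"
    using integral_nonneg_AE[of ?G M] by simp
  assume "(\<integral>x. t x / (1 + t x) \<partial>M) = (\<integral>x. s x / (1 + s x) \<partial>M)"
  with \<open>(\<integral>x. ?G x \<partial>M) = _\<close> have "(\<integral>x. ?G x \<partial>M) = 0" by simp
  then have "AE x in M. ?G x = 0"
    using integral_nonneg_eq_0_iff_AE[OF int_G] G_nonneg by auto
  then show "AE x in M. s x = t x"
  proof eventually_elim
    fix x assume "?G x = 0"
    moreover have "1 + s x \<noteq> 0" "1 + t x \<noteq> 0" using nonneg[of x] by linarith+
    ultimately show "s x = t x" by simp
  qed
qed

text \<open>No step lowers the functional and the cycle closes, so every inequality is an equality,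
  and the equality case identifies successive densities.\<close>

lemma cyclic_projections_constant:
  fixes \<nu> :: "nat \<Rightarrow> 'a measure" and r :: "nat \<Rightarrow> 'a \<Rightarrow> real"
  assumes "0 < p" and cycle: "\<nu> p = \<nu> 0"
    and prob: "\<And>i. i \<le> p \<Longrightarrow> prob_space (\<nu> i)"
    and r: "\<And>i. i \<in> {1..p} \<Longrightarrow> r i \<in> borel_measurable M" "\<And>i x. i \<in> {1..p} \<Longrightarrow> 0 \<le> r i x"
      "\<And>i. i \<in> {1..p} \<Longrightarrow> \<nu> i = density M (r i)"
    and marginal: "\<And>i. i < p \<Longrightarrow> (\<integral>\<^sup>+ x. ennreal (1 / (1 + r (Suc i) x)\<^sup>2) \<partial>\<nu> i) =
      (\<integral>\<^sup>+ x. ennreal (1 / (1 + r (Suc i) x)\<^sup>2) \<partial>\<nu> (Suc i))"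
    and "i \<le> p"
  shows "\<nu> i = \<nu> 0"
proof -
  \<comment> \<open>\<open>r\<close> describes the laws from index \<open>1\<close> on; the law at
    \<open>0\<close> borrows the density of the law at \<open>p\<close>, which it equals.\<close>
  define h where "h i = (if i = 0 then r p else r i)" for i
  have h [measurable]: "h i \<in> borel_measurable M" and h_nonneg: "0 \<le> h i x"
    and \<nu>_eq: "\<nu> i = density M (h i)" if "i \<le> p" for i x
    using r[of i] r[of p] that \<open>0 < p\<close> cycle by (auto simp: h_def)
  define \<Phi> where "\<Phi> i = (\<integral>x. h i x / (1 + h i x) \<partial>M)" for i
  have step: "\<Phi> i \<le> \<Phi> (Suc i)" "\<Phi> i = \<Phi> (Suc i) \<Longrightarrow> AE x in M. h (Suc i) x = h i x" if "i < p" for i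
  proof -
    have le: "i \<le> p" "Suc i \<le> p" using that by auto
    have eq: "(\<integral>\<^sup>+ x. ennreal (1 / (1 + h (Suc i) x)\<^sup>2) \<partial>density M (h i)) =
      (\<integral>\<^sup>+ x. ennreal (1 / (1 + h (Suc i) x)\<^sup>2) \<partial>density M (h (Suc i)))"
      using marginal[OF that] \<nu>_eq le by (simp add: h_def)
    have pr: "prob_space (density M (h i))" "prob_space (density M (h (Suc i)))"
      using prob[OF le(1)] prob[OF le(2)] \<nu>_eq[OF le(1)] \<nu>_eq[OF le(2)] by auto
    \<comment> \<open>The later density plays the role of \<open>s\<close>, since the test function
      in \<open>marginal\<close> is the derivative at \<open>r (Suc i)\<close>.\<close>
    note * = concave_functional_mono[OF h[OF le(2)] h[OF le(1)] h_nonneg[OF le(2)] h_nonneg[OF le(1)] pr(2,1) eq]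
    show "\<Phi> i \<le> \<Phi> (Suc i)" "\<Phi> i = \<Phi> (Suc i) \<Longrightarrow> AE x in M. h (Suc i) x = h i x"
      unfolding \<Phi>_def using * by auto
  qed
  have mono: "i \<le> k \<Longrightarrow> k \<le> p \<Longrightarrow> \<Phi> i \<le> \<Phi> k" for i k
    by (induction k rule: dec_induct) (auto intro: order_trans[OF _ step(1)])
  have \<Phi>_cycle: "\<Phi> p = \<Phi> 0" using \<open>0 < p\<close> by (simp add: \<Phi>_def h_def)
  have const: "\<Phi> i = \<Phi> 0" if "i \<le> p" for i
    using mono[of 0 i] mono[of i p] \<Phi>_cycle that by auto
  show ?thesis using \<open>i \<le> p\<close>
  proof (induction i)
    case (Suc i)
    then have "AE x in M. h (Suc i) x = h i x" using step(2)[of i] const[of i] const[of "Suc i"] by auto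
    then have "density M (h (Suc i)) = density M (h i)"
      using Suc.prems by (intro density_cong) auto
    with Suc \<nu>_eq[of i] \<nu>_eq[of "Suc i"] show ?case by auto
  qed simp
qed

subsection \<open>Imputation steps\<close>

lemma cell_partition:
  "Mis \<subseteq> cells n p \<Longrightarrow> finite (var_cells Mis j)"
  "Mis \<subseteq> cells n p \<Longrightarrow> finite (other_cells Mis j)"
  "other_cells Mis j \<inter> var_cells Mis j = {}"
  "other_cells Mis j \<union> var_cells Mis j = Mis"
  by (auto simp: cells_def var_cells_def other_cells_def intro: rev_finite_subset)

lemma product_sigma_finite_cells:
  "product_sigma_finite \<mu> \<Longrightarrow> product_sigma_finite (\<lambda>c::cell. \<mu> (snd c))"
  by (simp add: product_sigma_finite_def)

text \<open>
  At \<open>\<theta>\<close> with \<open>L \<theta> = 0\<close> the quotient \<open>h \<theta> y / L \<theta>\<close> is \<open>\<infinity>\<close> on a null set of \<open>y\<close>, and at \<open>\<theta>\<close> with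
  \<open>L \<theta> = \<infinity>\<close> it is \<open>0\<close>; both cases are negligible because \<open>h \<theta>\<close> vanishes almost everywhere in the
  first case and \<open>\<pi> \<theta>\<close> does in the second.
\<close>

lemma predictive_density_eq:
  fixes h :: "'t \<Rightarrow> 'b \<Rightarrow> ennreal" and N :: "'b measure"
  assumes T: "sigma_finite_measure T" and N: "sigma_finite_measure N"
    and [measurable]: "\<pi> \<in> borel_measurable T" "(\<lambda>(\<theta>, y). h \<theta> y) \<in> borel_measurable (T \<Otimes>\<^sub>M N)"
  defines "L \<equiv> \<lambda>\<theta>. \<integral>\<^sup>+ y. h \<theta> y \<partial>N"
  defines "e \<equiv> \<integral>\<^sup>+ \<theta>. \<pi> \<theta> * L \<theta> \<partial>T"
  assumes e: "0 < e" "e < \<infinity>"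
  shows "AE y in N. (\<integral>\<^sup>+ \<theta>. h \<theta> y / L \<theta> * (\<pi> \<theta> * L \<theta> / e) \<partial>T) * e = (\<integral>\<^sup>+ \<theta>. \<pi> \<theta> * h \<theta> y \<partial>T)"
proof -
  interpret T: sigma_finite_measure T by fact
  interpret N: sigma_finite_measure N by fact
  interpret TN: pair_sigma_finite T N ..
  have L [measurable]: "L \<in> borel_measurable T" unfolding L_def by measurable
  have "AE \<theta> in T. \<pi> \<theta> * L \<theta> \<noteq> \<infinity>"
    using e(2) by (intro nn_integral_noteq_infinite) (auto simp: e_def)
  then have "AE \<theta> in T. AE y in N. h \<theta> y / L \<theta> * (\<pi> \<theta> * L \<theta> / e) = \<pi> \<theta> * h \<theta> y / e"
    using AE_space
  proof eventually_elim
    fix \<theta> assume fin: "\<pi> \<theta> * L \<theta> \<noteq> \<infinity>" and [measurable]: "\<theta> \<in> space T"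
    consider "L \<theta> = 0" | "L \<theta> = \<infinity>" | "L \<theta> \<noteq> 0" "L \<theta> \<noteq> \<infinity>" by blast
    then show "AE y in N. h \<theta> y / L \<theta> * (\<pi> \<theta> * L \<theta> / e) = \<pi> \<theta> * h \<theta> y / e"
    proof cases
      case 1
      then have "AE y in N. h \<theta> y = 0"
        unfolding L_def by (subst (asm) nn_integral_0_iff_AE) auto
      then show ?thesis using 1 by auto
    next
      case 2
      then have "\<pi> \<theta> = 0" using fin by (auto simp: ennreal_mult_eq_top_iff)
      then show ?thesis by simp
    next
      case 3
      have "h \<theta> y / L \<theta> * (\<pi> \<theta> * L \<theta> / e) = \<pi> \<theta> * h \<theta> y / e" for y
      proof -
        have "h \<theta> y / L \<theta> * (\<pi> \<theta> * L \<theta> / e) = (h \<theta> y * L \<theta> / L \<theta>) * \<pi> \<theta> / e"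
          by (simp add: ennreal_times_divide ennreal_divide_times mult.commute mult.left_commute)
        also have "h \<theta> y * L \<theta> / L \<theta> = h \<theta> y" using 3 by (simp add: mult_divide_eq_ennreal)
        finally show ?thesis by (simp add: mult.commute)
      qed
      then show ?thesis by simp
    qed
  qed
  \<comment> \<open>So far the exceptional set of \<open>y\<close> depends on
    \<open>\<theta>\<close>. Exchanging the two quantifiers gives, for almost every
    \<open>y\<close>, equality of the integrands in \<open>\<theta>\<close>.\<close>
  then have "AE y in N. AE \<theta> in T. h \<theta> y / L \<theta> * (\<pi> \<theta> * L \<theta> / e) = \<pi> \<theta> * h \<theta> y / e"
    by (subst (asm) TN.AE_commute) auto
  then show ?thesis
    using AE_space
  proof eventually_elim
    fix y assume ae: "AE \<theta> in T. h \<theta> y / L \<theta> * (\<pi> \<theta> * L \<theta> / e) = \<pi> \<theta> * h \<theta> y / e"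
      and [measurable]: "y \<in> space N"
    have "(\<integral>\<^sup>+ \<theta>. h \<theta> y / L \<theta> * (\<pi> \<theta> * L \<theta> / e) \<partial>T) * e = (\<integral>\<^sup>+ \<theta>. \<pi> \<theta> * h \<theta> y / e \<partial>T) * e"
      using ae by (simp cong: nn_integral_cong_AE)
    also have "\<dots> = (\<integral>\<^sup>+ \<theta>. \<pi> \<theta> * h \<theta> y \<partial>T) / e * e"
      by (subst nn_integral_divide) auto
    also have "\<dots> = (\<integral>\<^sup>+ \<theta>. \<pi> \<theta> * h \<theta> y \<partial>T)"
      using e mult_divide_eq_ennreal[of e] by (simp add: ennreal_divide_times)
    finally show "(\<integral>\<^sup>+ \<theta>. h \<theta> y / L \<theta> * (\<pi> \<theta> * L \<theta> / e) \<partial>T) * e = (\<integral>\<^sup>+ \<theta>. \<pi> \<theta> * h \<theta> y \<partial>T)" .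
  qed
qed

text \<open>What joint and conditional models share at step \<open>j\<close>: Bayes' rule has the
  same form in both, with \<open>h\<close> standing for \<open>f\<close> or for
  \<open>g j\<close>.\<close>

locale imputation_model =
  fixes n p :: nat and \<mu> :: "nat \<Rightarrow> 'a measure" and Mis :: "cell set" and xobs :: "cell \<Rightarrow> 'a"
    and T :: "'t measure" and \<pi> :: "'t \<Rightarrow> ennreal" and h :: "'t \<Rightarrow> (cell \<Rightarrow> 'a) \<Rightarrow> ennreal"
    and j :: nat
  assumes \<mu>: "product_sigma_finite \<mu>" and Mis: "Mis \<subseteq> cells n p"
    and xobs: "xobs \<in> space (cell_space \<mu> (cells n p - Mis))"
    and T: "sigma_finite_measure T" and \<pi> [measurable]: "\<pi> \<in> borel_measurable T"
    and h: "(\<lambda>(\<theta>, x). h \<theta> x) \<in> borel_measurable (T \<Otimes>\<^sub>M cell_space \<mu> (cells n p))"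
    and posterior: "posterior_exists \<mu> Mis xobs T \<pi> h j"
begin

abbreviation "D \<equiv> \<lambda>c::cell. \<mu> (snd c)"
abbreviation "U \<equiv> other_cells Mis j"
abbreviation "V \<equiv> var_cells Mis j"

lemma h_measurable [measurable (raw)]:
  assumes "f \<in> N \<rightarrow>\<^sub>M T" "x \<in> N \<rightarrow>\<^sub>M cell_space \<mu> (cells n p)"
  shows "(\<lambda>z. h (f z) (x z)) \<in> borel_measurable N"
  using measurable_compose[OF measurable_Pair[OF assms] h] by simp

lemma override_measurable [measurable]:
  "(\<lambda>x. override_on xobs x Mis) \<in> PiM Mis D \<rightarrow>\<^sub>M cell_space \<mu> (cells n p)"
proof -
  \<comment> \<open>Outside \<open>cells n p\<close> both sides are \<open>undefined\<close>,
    because \<open>xobs\<close> is extensional on the observed cells.\<close>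
  have eq: "override_on xobs x Mis = merge Mis (cells n p - Mis) (x, xobs)" for x
    using xobs by (auto simp: cell_space_def space_PiM PiE_iff extensional_def override_on_def merge_def)
  have un: "Mis \<union> (cells n p - Mis) = cells n p" using Mis by auto
  have "(\<lambda>x. merge Mis (cells n p - Mis) (x, xobs)) \<in>
      PiM Mis D \<rightarrow>\<^sub>M PiM (Mis \<union> (cells n p - Mis)) D"
    using xobs unfolding cell_space_def by measurable
  then show ?thesis unfolding eq un cell_space_def .
qed

lemma complete_measurable [measurable (raw)]:
  assumes [measurable]: "u \<in> N \<rightarrow>\<^sub>M PiM U D" "y \<in> N \<rightarrow>\<^sub>M PiM V D"
  shows "(\<lambda>z. complete Mis xobs j (u z) (y z)) \<in> N \<rightarrow>\<^sub>M cell_space \<mu> (cells n p)"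
proof -
  have "(\<lambda>z. merge U V (u z, y z)) \<in> N \<rightarrow>\<^sub>M PiM (U \<union> V) D" by measurable
  then show ?thesis
    unfolding complete_def cell_partition(4) by measurable
qed

lemma sigma_finite_V: "sigma_finite_measure (PiM V D)"
  using product_sigma_finite.sigma_finite[OF product_sigma_finite_cells[OF \<mu>] cell_partition(1)[OF Mis]] .

lemma obs_lik_measurable [measurable (raw)]:
  assumes [measurable]: "f \<in> N \<rightarrow>\<^sub>M T" "u \<in> N \<rightarrow>\<^sub>M PiM U D"
  shows "(\<lambda>z. obs_lik \<mu> Mis xobs h j (u z) (f z)) \<in> borel_measurable N"
proof -
  interpret V: sigma_finite_measure "PiM V D" by (rule sigma_finite_V)
  show ?thesis unfolding obs_lik_def cell_space_def by measurable
qed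

lemma evidence_measurable [measurable]:
  "evidence \<mu> Mis xobs T \<pi> h j \<in> borel_measurable (PiM U D)"
proof -
  interpret T: sigma_finite_measure T by (rule T)
  show ?thesis unfolding evidence_def[abs_def] by measurable
qed

lemma evidence_pos:
  "u \<in> space (PiM U D) \<Longrightarrow> 0 < evidence \<mu> Mis xobs T \<pi> h j u \<and> evidence \<mu> Mis xobs T \<pi> h j u < \<infinity>"
  using posterior by (simp add: posterior_exists_def cell_space_def)

definition predictive :: "(cell \<Rightarrow> 'a) \<Rightarrow> (cell \<Rightarrow> 'a) \<Rightarrow> ennreal" where
  "predictive u y =
    (\<integral>\<^sup>+ \<theta>. cond_density \<mu> Mis xobs h j u \<theta> y * posterior_density \<mu> Mis xobs T \<pi> h j u \<theta> \<partial>T)"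

lemma predictive_measurable:
  "(\<lambda>(u, y). predictive u y) \<in> borel_measurable (PiM U D \<Otimes>\<^sub>M PiM V D)"
proof -
  interpret T: sigma_finite_measure T by (rule T)
  show ?thesis
    unfolding predictive_def cond_density_def posterior_density_def by measurable
qed

text \<open>The observed likelihood divides the conditional density and multiplies the posterior, so
  it cancels; the evidence is left as the only normaliser.\<close>

lemma predictive_eq:
  assumes u: "u \<in> space (PiM U D)"
  shows "AE y in PiM V D. predictive u y * evidence \<mu> Mis xobs T \<pi> h j u =
    (\<integral>\<^sup>+ \<theta>. \<pi> \<theta> * h \<theta> (complete Mis xobs j u y) \<partial>T)"
proof -
  note [measurable] = measurable_const[OF u]
  show ?thesis
    using predictive_density_eq[OF T sigma_finite_V \<pi>, of "\<lambda>\<theta> y. h \<theta> (complete Mis xobs j u y)"]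
      evidence_pos[OF u]
    by (simp add: predictive_def cond_density_def posterior_density_def obs_lik_def evidence_def
        cell_space_def)
qed

text \<open>By Tonelli the unnormalised predictive density integrates to the evidence, which is
  positive and finite and so cancels.\<close>

lemma predictive_mass:
  assumes u: "u \<in> space (PiM U D)"
  shows "(\<integral>\<^sup>+ y. predictive u y \<partial>PiM V D) = 1"
proof -
  interpret T: sigma_finite_measure T by (rule T)
  interpret V: sigma_finite_measure "PiM V D" by (rule sigma_finite_V)
  interpret TV: pair_sigma_finite T "PiM V D" ..
  note [measurable] = measurable_const[OF u] predictive_measurable
  let ?e = "evidence \<mu> Mis xobs T \<pi> h j u"
  have "(\<integral>\<^sup>+ y. predictive u y \<partial>PiM V D) * ?e = (\<integral>\<^sup>+ y. predictive u y * ?e \<partial>PiM V D)"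
    using measurable_compose[OF measurable_Pair predictive_measurable, of "\<lambda>_. u" "PiM V D" "\<lambda>y. y"] u
    by (subst nn_integral_multc) auto
  also have "\<dots> = (\<integral>\<^sup>+ y. (\<integral>\<^sup>+ \<theta>. \<pi> \<theta> * h \<theta> (complete Mis xobs j u y) \<partial>T) \<partial>PiM V D)"
    by (rule nn_integral_cong_AE[OF predictive_eq[OF u]])
  also have "\<dots> = (\<integral>\<^sup>+ \<theta>. (\<integral>\<^sup>+ y. \<pi> \<theta> * h \<theta> (complete Mis xobs j u y) \<partial>PiM V D) \<partial>T)"
    by (rule TV.Fubini') measurable
  also have "\<dots> = ?e"
    unfolding evidence_def obs_lik_def cell_space_def
    by (intro nn_integral_cong nn_integral_cmult) measurable
  finally have "(\<integral>\<^sup>+ y. predictive u y \<partial>PiM V D) * ?e = ?e" .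
  moreover have "?e \<noteq> 0" "?e \<noteq> \<top>" using evidence_pos[OF u] by auto
  ultimately show ?thesis
    using mult_divide_eq_ennreal[of ?e "\<integral>\<^sup>+ y. predictive u y \<partial>PiM V D"]
      mult_divide_eq_ennreal[of ?e 1] by simp
qed

sublocale block_update D U V predictive
  using product_sigma_finite_cells[OF \<mu>] cell_partition(1,2)[OF Mis] predictive_measurable predictive_mass
  by (auto simp: block_update_def block_update_axioms_def cell_partition(3))

lemma post_pred_eq: "post_pred \<mu> Mis xobs T \<pi> h j u = density (PiM V D) (predictive u)"
  by (simp add: post_pred_def predictive_def[abs_def] cell_space_def)

lemma impute_step_eq: "impute_step \<mu> Mis xobs T \<pi> h j = kernel"
  by (rule ext) (simp add: impute_step_def kernel_def post_pred_eq cell_space_def cell_partition(4) Let_def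
      del: merge_restrict)

text \<open>For a joint model this is the marginal likelihood of the complete data, as a function of
  the missing cells. The formula does not involve \<open>j\<close>, so all Gibbs steps share one
  reference measure.\<close>

definition joint_density :: "(cell \<Rightarrow> 'a) \<Rightarrow> ennreal" where
  "joint_density x = (\<integral>\<^sup>+ \<theta>. \<pi> \<theta> * h \<theta> (override_on xobs x Mis) \<partial>T)"

lemma joint_density_measurable: "joint_density \<in> borel_measurable (PiM Mis D)"
proof -
  interpret T: sigma_finite_measure T by (rule T)
  show ?thesis unfolding joint_density_def[abs_def] by measurable
qed

lemma predictive_joint_density:
  "u \<in> space (PiM U D) \<Longrightarrow>
    AE y in PiM V D. predictive u y * evidence \<mu> Mis xobs T \<pi> h j u = joint_density (merge U V (u, y))"
  using predictive_eq by (simp add: joint_density_def complete_def)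

end

section \<open>Laws of the missing data within a scan\<close>

lemma law_after_0 [simp]: "law_after K 0 \<nu> = \<nu>"
  by (simp add: law_after_def)

lemma law_after_Suc [simp]: "law_after K (Suc i) \<nu> = law_after K i \<nu> \<bind> K (Suc i)"
  by (simp add: law_after_def)

lemma law_after_measure:
  fixes T :: "nat \<Rightarrow> 't measure"
  assumes model: "\<And>i. i \<in> {1..p} \<Longrightarrow> imputation_model n p \<mu> Mis xobs (T i) (\<pi> i) (h i) i"
    and K: "\<And>i. K i = impute_step \<mu> Mis xobs (T i) (\<pi> i) (h i) i"
    and \<nu>: "prob_space \<nu>" "sets \<nu> = sets (cell_space \<mu> Mis)"
    and "i \<le> p"
  shows law_after_prob: "prob_space (law_after K i \<nu>)"
    and law_after_sets: "sets (law_after K i \<nu>) = sets (cell_space \<mu> Mis)"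
proof -
  have "prob_space (law_after K i \<nu>) \<and> sets (law_after K i \<nu>) = sets (cell_space \<mu> Mis)"
    using \<open>i \<le> p\<close>
  proof (induction i)
    case (Suc i)
    interpret imputation_model n p \<mu> Mis xobs "T (Suc i)" "\<pi> (Suc i)" "h (Suc i)" "Suc i"
      using Suc.prems by (intro model) auto
    have K_kernel: "K (Suc i) = kernel" using K impute_step_eq by simp
    show ?case
      using prob_space_bind_kernel[of "law_after K i \<nu>"] sets_bind_kernel[of "law_after K i \<nu>"] Suc
      by (simp add: K_kernel cell_space_def cell_partition(4))
  qed (use \<nu> in simp)
  then show "prob_space (law_after K i \<nu>)" "sets (law_after K i \<nu>) = sets (cell_space \<mu> Mis)" by auto
qed

text \<open>
  The variables updated so far have an absolutely continuous joint law whatever the initial law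
  is, so that a law invariant under a full scan is absolutely continuous.
\<close>

lemma law_after_absolutely_continuous:
  fixes T :: "nat \<Rightarrow> 't measure"
  assumes model: "\<And>i. i \<in> {1..p} \<Longrightarrow> imputation_model n p \<mu> Mis xobs (T i) (\<pi> i) (h i) i"
    and Mis: "Mis \<subseteq> cells n p"
    and K: "\<And>i. K i = impute_step \<mu> Mis xobs (T i) (\<pi> i) (h i) i"
    and \<nu>: "prob_space \<nu>" "sets \<nu> = sets (cell_space \<mu> Mis)"
    and "i \<le> p"
  shows "absolutely_continuous (cell_space \<mu> {c \<in> Mis. snd c \<le> i})
    (distr (law_after K i \<nu>) (cell_space \<mu> {c \<in> Mis. snd c \<le> i}) (\<lambda>x. restrict x {c \<in> Mis. snd c \<le> i}))"
  using \<open>i \<le> p\<close>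
proof (induction i)
  case 0
  \<comment> \<open>Variables are numbered from \<open>1\<close>, so no cell is updated yet; the
    empty product is a single point of mass one, whose only null set is empty.\<close>
  have empty: "{c \<in> Mis. snd c \<le> 0} = {}" using Mis by (auto simp: cells_def)
  have "N = {}" if "N \<in> null_sets (cell_space \<mu> {})" for N
    using that by (auto simp: cell_space_def PiM_empty null_sets_count_space)
  then show ?case unfolding empty absolutely_continuous_def by (metis null_sets.empty_sets subsetI)
next
  case (Suc i)
  interpret imputation_model n p \<mu> Mis xobs "T (Suc i)" "\<pi> (Suc i)" "h (Suc i)" "Suc i"
    using Suc.prems by (intro model) auto
  have prob: "prob_space (law_after K i \<nu>)"
    and sets: "sets (law_after K i \<nu>) = sets (PiM (other_cells Mis (Suc i) \<union> var_cells Mis (Suc i)) D)"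
    using law_after_measure[OF model K \<nu>, of i] Suc.prems
    by (auto simp: cell_space_def cell_partition(4))
  \<comment> \<open>Variables not yet updated in this scan lie in the kept block but outside
    \<open>W\<close>, where absolute continuity is not claimed.\<close>
  have W: "{c \<in> Mis. snd c \<le> i} \<subseteq> other_cells Mis (Suc i)" by (auto simp: other_cells_def)
  have un: "{c \<in> Mis. snd c \<le> i} \<union> var_cells Mis (Suc i) = {c \<in> Mis. snd c \<le> Suc i}"
    by (auto simp: var_cells_def)
  have K_kernel: "K (Suc i) = kernel" using K impute_step_eq by simp
  show ?case
    using absolutely_continuous_bind_kernel[OF prob sets W
        Suc.IH[OF Suc_leD[OF Suc.prems], unfolded cell_space_def]]
    unfolding law_after_Suc K_kernel cell_space_def un .
qed

text \<open>Absolute continuity of \<open>\<nu>\<close> provides densities of all laws in the scan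
  with respect to one measure \<open>M\<close>, each a function of the cells kept in the step just
  made. Then \<open>cyclic_projections_constant\<close> applies.\<close>

lemma gibbs_steps_stationary:
  fixes \<mu> :: "nat \<Rightarrow> 'a measure"
  assumes model: "\<And>i. i \<in> {1..p} \<Longrightarrow> imputation_model n p \<mu> Mis xobs T \<pi> f i"
    and Mis: "Mis \<subseteq> cells n p"
    and K: "\<And>i. K i = impute_step \<mu> Mis xobs T \<pi> f i"
    and stat: "stationary_distribution (cell_space \<mu> Mis) p K \<nu>"
    and "i \<le> p"
  shows "law_after K i \<nu> = \<nu>"
proof (cases "p = 0")
  case True
  then show ?thesis using \<open>i \<le> p\<close> by simp
next
  case False
  have \<nu>: "prob_space \<nu>" "sets \<nu> = sets (cell_space \<mu> Mis)" and inv: "law_after K p \<nu> = \<nu>"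
    using stat by (auto simp: stationary_distribution_def)
  let ?D = "\<lambda>c::cell. \<mu> (snd c)"
  \<comment> \<open>This is the \<open>joint_density\<close> of every interpretation below, named
    outside the locale because the steps interpret it at different indices.\<close>
  define m where "m x = (\<integral>\<^sup>+ \<theta>. \<pi> \<theta> * f \<theta> (override_on xobs x Mis) \<partial>T)" for x
  define M where "M = density (PiM Mis ?D) m"
  have law: "prob_space (law_after K i \<nu>)" "sets (law_after K i \<nu>) = sets (PiM Mis ?D)" if "i \<le> p" for i
    using law_after_measure[OF model K \<nu> that] by (auto simp: cell_space_def)
  \<comment> \<open>A full scan updates every missing cell, and by invariance the law after it is
    \<open>\<nu>\<close> itself.\<close>
  have ac0: "absolutely_continuous (PiM Mis ?D) \<nu>"
  proof -
    have "{c \<in> Mis. snd c \<le> p} = Mis" using Mis by (auto simp: cells_def)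
    moreover have "distr \<nu> (PiM Mis ?D) (\<lambda>x. restrict x Mis) = distr \<nu> \<nu> (\<lambda>x. x)"
    proof (rule distr_cong)
      have "space \<nu> = space (PiM Mis ?D)"
        using \<nu>(2) by (intro sets_eq_imp_space_eq) (simp add: cell_space_def)
      then show "restrict x Mis = x" if "x \<in> space \<nu>" for x
        using that by (auto simp: space_PiM PiE_iff extensional_restrict)
    qed (use \<nu>(2) in \<open>auto simp: cell_space_def\<close>)
    ultimately show ?thesis
      using law_after_absolutely_continuous[OF model Mis K \<nu> order_refl]
      by (simp add: inv cell_space_def distr_id)
  qed
  have step: "\<exists>r. r \<in> borel_measurable (PiM (other_cells Mis (Suc i)) ?D) \<and> (\<forall>u. 0 \<le> r u) \<and>
      law_after K (Suc i) \<nu> = density M (\<lambda>x. ennreal (r (restrict x (other_cells Mis (Suc i)))))"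
    if "i < p" and ac: "absolutely_continuous (PiM Mis ?D) (law_after K i \<nu>)" for i
  proof -
    interpret imputation_model n p \<mu> Mis xobs T \<pi> f "Suc i"
      using that by (intro model) auto
    have sets: "sets (law_after K i \<nu>) = sets (PiM (other_cells Mis (Suc i) \<union> var_cells Mis (Suc i)) ?D)"
      using law(2)[of i] that by (simp add: cell_partition(4))
    have Jm: "joint_density = m" by (rule ext) (simp add: joint_density_def m_def)
    have K_kernel: "K (Suc i) = kernel" using K impute_step_eq by simp
    have i: "i \<le> p" using that by simp
    show ?thesis
    proof (rule bind_kernel_density[OF law(1)[OF i] sets, unfolded cell_partition(4)])
      show "absolutely_continuous (PiM Mis ?D) (law_after K i \<nu>)" by (rule ac)
      show "m \<in> borel_measurable (PiM Mis ?D)" using joint_density_measurable by (simp add: Jm)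
      show "evidence \<mu> Mis xobs T \<pi> f (Suc i) \<in> borel_measurable (PiM (other_cells Mis (Suc i)) ?D)"
        by (rule evidence_measurable)
    next
      fix u assume u: "u \<in> space (PiM (other_cells Mis (Suc i)) ?D)"
      show "0 < evidence \<mu> Mis xobs T \<pi> f (Suc i) u \<and> evidence \<mu> Mis xobs T \<pi> f (Suc i) u < \<infinity>"
        by (rule evidence_pos[OF u])
      show "AE y in PiM (var_cells Mis (Suc i)) ?D. predictive u y * evidence \<mu> Mis xobs T \<pi> f (Suc i) u =
          m (merge (other_cells Mis (Suc i)) (var_cells Mis (Suc i)) (u, y))"
        using predictive_joint_density[OF u] by (simp add: Jm)
    next
      fix r :: "(cell \<Rightarrow> 'a) \<Rightarrow> real"
      assume "r \<in> borel_measurable (PiM (other_cells Mis (Suc i)) ?D)" "\<And>u. 0 \<le> r u"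
        "law_after K i \<nu> \<bind> kernel =
          density (density (PiM Mis ?D) m) (\<lambda>x. ennreal (r (restrict x (other_cells Mis (Suc i)))))"
      then show ?thesis by (auto simp: K_kernel M_def)
    qed
  qed
  have acM: "absolutely_continuous (PiM Mis ?D) (law_after K i \<nu>)" if "i \<le> p" for i
    using that
  proof (induction i)
    case (Suc i)
    interpret imputation_model n p \<mu> Mis xobs T \<pi> f "Suc i"
      using Suc.prems by (intro model) auto
    have [measurable]: "m \<in> borel_measurable (PiM Mis ?D)"
      using joint_density_measurable by (simp add: joint_density_def[abs_def] m_def[abs_def])
    have [measurable]: "(\<lambda>x. restrict x (other_cells Mis (Suc i))) \<in> PiM Mis D \<rightarrow>\<^sub>M PiM (other_cells Mis (Suc i)) D"
      by (rule measurable_restrict_subset) (auto simp: other_cells_def)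
    from step[of i] Suc obtain r where [measurable]: "r \<in> borel_measurable (PiM (other_cells Mis (Suc i)) ?D)"
      and eq: "law_after K (Suc i) \<nu> = density M (\<lambda>x. ennreal (r (restrict x (other_cells Mis (Suc i)))))"
      by auto
    show ?case
      unfolding eq M_def by (subst density_density_eq) (auto intro: absolutely_continuousI_density)
  qed (use ac0 in simp)
  obtain r where r: "\<And>i. i < p \<Longrightarrow> r i \<in> borel_measurable (PiM (other_cells Mis (Suc i)) ?D)"
      "\<And>i u. i < p \<Longrightarrow> 0 \<le> (r i u :: real)"
      "\<And>i. i < p \<Longrightarrow> law_after K (Suc i) \<nu> = density M (\<lambda>x. ennreal (r i (restrict x (other_cells Mis (Suc i)))))"
    using step acM by (metis less_imp_le)
  have restr: "(\<lambda>x. restrict x (other_cells Mis i)) \<in> M \<rightarrow>\<^sub>M PiM (other_cells Mis i) ?D" for i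
    unfolding M_def measurable_density_eq1 by (rule measurable_restrict_subset) (auto simp: other_cells_def)
  have "law_after K i \<nu> = law_after K 0 \<nu>"
  \<comment> \<open>\<open>r i\<close> was chosen for the law after step \<open>Suc i\<close>, hence
    the shift to \<open>r (i - 1)\<close>.\<close>
  proof (rule cyclic_projections_constant[where r = "\<lambda>i x. r (i - 1) (restrict x (other_cells Mis i))" and M = M])
    fix i assume "i \<in> {1..p}"
    then obtain k where i: "i = Suc k" "k < p" by (cases i) auto
    show "(\<lambda>x. r (i - 1) (restrict x (other_cells Mis i))) \<in> borel_measurable M"
      using measurable_compose[OF restr r(1)] i by simp
    show "0 \<le> r (i - 1) (restrict x (other_cells Mis i))" for x using r(2) i by simp
    show "law_after K i \<nu> = density M (\<lambda>x. ennreal (r (i - 1) (restrict x (other_cells Mis i))))"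
      using r(3) i by simp
  next
    fix i assume "i < p"
    interpret imputation_model n p \<mu> Mis xobs T \<pi> f "Suc i"
      using \<open>i < p\<close> by (intro model) auto
    have sets: "sets (law_after K i \<nu>) = sets (PiM (other_cells Mis (Suc i) \<union> var_cells Mis (Suc i)) ?D)"
      using law(2)[of i] \<open>i < p\<close> by (simp add: cell_partition(4))
    note [measurable] = r(1)[OF \<open>i < p\<close>]
    \<comment> \<open>The test function sees only the cells kept in step \<open>Suc i\<close>, whose
      marginal law that step preserves.\<close>
    have "(\<lambda>u. ennreal (1 / (1 + r i u)\<^sup>2)) \<in> borel_measurable (PiM (other_cells Mis (Suc i)) ?D)"
      by measurable
    then show "(\<integral>\<^sup>+ x. ennreal (1 / (1 + r (Suc i - 1) (restrict x (other_cells Mis (Suc i))))\<^sup>2) \<partial>law_after K i \<nu>) =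
        (\<integral>\<^sup>+ x. ennreal (1 / (1 + r (Suc i - 1) (restrict x (other_cells Mis (Suc i))))\<^sup>2) \<partial>law_after K (Suc i) \<nu>)"
      using nn_integral_bind_kernel_marginal[OF law(1)[OF less_imp_le[OF \<open>i < p\<close>]] sets,
          of "\<lambda>u. ennreal (1 / (1 + r i u)\<^sup>2)"]
      by (simp add: K impute_step_eq)
  qed (use False inv law \<open>i \<le> p\<close> in auto)
  then show ?thesis by simp
qed

section \<open>Separating the two laws by a cylinder or a rectangle\<close>

text \<open>In the first case \<open>a * c2 - b * c1 = (a - b) * c1 - a * (c1 - c2)\<close>, and in
  the second \<open>a * c1 - b * c2 = (a - b) * c1 - b * (c2 - c1)\<close>. The leading term exceeds
  \<open>q * \<epsilon>\<close> and the correction is at most a quarter of that.\<close>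

lemma separated_rectangles:
  fixes a b c1 c2 r1 r2 \<epsilon> q :: real
  assumes "b + \<epsilon> < a" "a \<le> 1" "b \<le> 1" "0 \<le> b" "0 < \<epsilon>" "0 < q" "q < c1"
    and "(a * c2 \<le> r2 \<and> r1 \<le> b * c1) \<or> (a * c1 \<le> r1 \<and> r2 \<le> b * c2)"
    and le: "\<bar>c2 - c1\<bar> \<le> q * \<epsilon> / 4"
  shows "\<bar>r2 - r1\<bar> > q * \<epsilon> / 4"
proof -
  let ?\<delta> = "q * \<epsilon> / 4"
  have gap: "q * \<epsilon> < (a - b) * c1"
    using assms mult_strict_mono[of \<epsilon> "a - b" q c1] by (simp add: mult.commute)
  have pos: "0 < ?\<delta>" using assms by simp
  have diff: "c1 - c2 \<le> ?\<delta>" "c2 - c1 \<le> ?\<delta>" using le by linarith+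
  from assms(8) show ?thesis
  proof
    assume *: "a * c2 \<le> r2 \<and> r1 \<le> b * c1"
    have "a * (c1 - c2) \<le> a * ?\<delta>" using diff assms(1-6) by (intro mult_left_mono) linarith+
    also have "\<dots> \<le> 1 * ?\<delta>" using pos assms by (intro mult_right_mono) auto
    finally show ?thesis using * gap pos by (simp add: algebra_simps)
  next
    assume *: "a * c1 \<le> r1 \<and> r2 \<le> b * c2"
    have "b * (c2 - c1) \<le> b * ?\<delta>" using diff assms(1-6) by (intro mult_left_mono) linarith+
    also have "\<dots> \<le> 1 * ?\<delta>" using pos assms by (intro mult_right_mono) auto
    finally show ?thesis using * gap pos by (simp add: algebra_simps)
  qed
qed

theorem theorem2:
  fixes n p :: nat
    and \<mu> :: "nat \<Rightarrow> 'a measure"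
    and Mis :: "cell set" and xobs :: "cell \<Rightarrow> 'a"
    and T :: "'t measure" and \<pi> :: "'t \<Rightarrow> ennreal"
    and f :: "'t \<Rightarrow> (cell \<Rightarrow> 'a) \<Rightarrow> ennreal"
    and S :: "nat \<Rightarrow> 's measure" and \<psi> :: "nat \<Rightarrow> 's \<Rightarrow> ennreal"
    and g :: "nat \<Rightarrow> 's \<Rightarrow> (cell \<Rightarrow> 'a) \<Rightarrow> ennreal"
    and \<nu>1 \<nu>2 :: "(cell \<Rightarrow> 'a) measure"
    and A C :: "(cell \<Rightarrow> 'a) set"
    and j :: nat and \<epsilon> q :: real
  defines "Pf \<equiv> (\<lambda>i. post_pred \<mu> Mis xobs T \<pi> f i)"
    and "Pg \<equiv> (\<lambda>i. post_pred \<mu> Mis xobs (S i) (\<psi> i) (g i) i)"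
    and "gibbs \<equiv> (\<lambda>i. impute_step \<mu> Mis xobs T \<pi> f i)"
    and "iterative \<equiv> (\<lambda>i. impute_step \<mu> Mis xobs (S i) (\<psi> i) (g i) i)"
  assumes "product_sigma_finite \<mu>"
    and "Mis \<subseteq> cells n p"
    and "xobs \<in> space (cell_space \<mu> (cells n p - Mis))"
    and "joint_model n p \<mu> T \<pi> f"
    and "\<And>i. i \<in> {1..p} \<Longrightarrow> posterior_exists \<mu> Mis xobs T \<pi> f i"
    and "\<And>i. i \<in> {1..p} \<Longrightarrow> conditional_model n p \<mu> (S i) (\<psi> i) (g i) i"
    and "\<And>i. i \<in> {1..p} \<Longrightarrow> posterior_exists \<mu> Mis xobs (S i) (\<psi> i) (g i) i"
    and "stationary_distribution (cell_space \<mu> Mis) p gibbs \<nu>1"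
    and "stationary_distribution (cell_space \<mu> Mis) p iterative \<nu>2"
    and "j \<in> {1..p}"
    and "A \<in> sets (cell_space \<mu> (var_cells Mis j))"
    and "C \<in> sets (cell_space \<mu> (other_cells Mis j))"
    and "0 < \<epsilon>" and "\<epsilon> < 1 / 2"
    and "(INF u\<in>C. measure (Pg j u) A) > (SUP u\<in>C. measure (Pf j u) A) + \<epsilon> \<or>
         (SUP u\<in>C. measure (Pg j u) A) < (INF u\<in>C. measure (Pf j u) A) - \<epsilon>"
    and "0 < q" and "q < 1"
    and "measure \<nu>1 {x \<in> space \<nu>1. restrict x (other_cells Mis j) \<in> C} > q"
  shows "\<exists>B \<in> sets (cell_space \<mu> Mis).
    \<bar>measure (law_after iterative j \<nu>2) B - measure \<nu>1 B\<bar> > q * \<epsilon> / 4"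
proof -
  let ?U = "other_cells Mis j" and ?V = "var_cells Mis j" and ?D = "\<lambda>c::cell. \<mu> (snd c)"
  have gibbs_model: "imputation_model n p \<mu> Mis xobs T \<pi> f i" if "i \<in> {1..p}" for i
    using assms(5-8) assms(9)[OF that]
    by (auto simp: imputation_model_def joint_model_def)
  have iter_model: "imputation_model n p \<mu> Mis xobs (S i) (\<psi> i) (g i) i" if "i \<in> {1..p}" for i
    using assms(5-7) assms(10)[OF that] assms(11)[OF that]
    by (auto simp: imputation_model_def conditional_model_def)
  have j: "j \<in> {1..p}" by fact
  then obtain k where k: "j = Suc k" "k \<le> p" by (cases j) auto
  interpret F: imputation_model n p \<mu> Mis xobs T \<pi> f j by (rule gibbs_model[OF j])
  interpret G: imputation_model n p \<mu> Mis xobs "S j" "\<psi> j" "g j" j by (rule iter_model[OF j])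
  have \<nu>1: "prob_space \<nu>1" "sets \<nu>1 = sets (PiM (?U \<union> ?V) ?D)"
    and \<nu>2: "prob_space \<nu>2" "sets \<nu>2 = sets (cell_space \<mu> Mis)"
    using assms(12,13) by (auto simp: stationary_distribution_def cell_partition(4) cell_space_def)
  have gibbs_fixed: "law_after gibbs i \<nu>1 = \<nu>1" if "i \<le> p" for i
    by (rule gibbs_steps_stationary[OF gibbs_model assms(6) _ assms(12) that]) (simp_all add: gibbs_def)
  \<comment> \<open>With \<open>k = j - 1\<close>, the laws before and after step \<open>j\<close>
    are both \<open>\<nu>1\<close>, so this single step fixes \<open>\<nu>1\<close>.\<close>
  have "law_after gibbs j \<nu>1 = law_after gibbs k \<nu>1 \<bind> gibbs j"
    by (simp add: k)
  moreover have "gibbs j = F.kernel"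
    by (simp add: gibbs_def F.impute_step_eq)
  ultimately have \<nu>1_eq: "\<nu>1 \<bind> F.kernel = \<nu>1"
    using gibbs_fixed[of k] gibbs_fixed[of j] k(2) j by simp
  \<comment> \<open>The law just before step \<open>j\<close>. It enters only as some probability
    law; what matters is that step \<open>j\<close> is applied to it last.\<close>
  define \<rho> where "\<rho> = law_after iterative k \<nu>2"
  have \<rho>: "prob_space \<rho>" "sets \<rho> = sets (PiM (?U \<union> ?V) ?D)"
    using law_after_measure[OF iter_model _ \<nu>2 k(2), of iterative]
    by (auto simp: \<rho>_def iterative_def cell_partition(4) cell_space_def)
  have "law_after iterative j \<nu>2 = \<rho> \<bind> iterative j"
    by (simp add: k \<rho>_def)
  then have law_j: "law_after iterative j \<nu>2 = \<rho> \<bind> G.kernel"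
    by (simp add: iterative_def G.impute_step_eq)
  have A: "A \<in> sets (PiM ?V ?D)" and C: "C \<in> sets (PiM ?U ?D)"
    using assms(15,16) by (simp_all add: cell_space_def)
  \<comment> \<open>\<open>cyl\<close> and \<open>rect\<close> are the two candidates for
    \<open>B\<close>.\<close>
  define cyl where "cyl = {x \<in> space (PiM (?U \<union> ?V) ?D). restrict x ?U \<in> C}"
  define rect where "rect = {x \<in> space (PiM (?U \<union> ?V) ?D). restrict x ?U \<in> C \<and> restrict x ?V \<in> A}"
  note [measurable] = A C
  have cyl_sets: "cyl \<in> sets (cell_space \<mu> Mis)" and rect_sets: "rect \<in> sets (cell_space \<mu> Mis)"
  proof -
    have "cyl \<in> sets (PiM (?U \<union> ?V) ?D)" "rect \<in> sets (PiM (?U \<union> ?V) ?D)"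
      unfolding cyl_def rect_def using F.restrict_U F.restrict_V by measurable
    then show "cyl \<in> sets (cell_space \<mu> Mis)" "rect \<in> sets (cell_space \<mu> Mis)"
      by (simp_all add: cell_partition(4) cell_space_def)
  qed
  have q: "q < measure \<nu>1 cyl"
    using assms(22) sets_eq_imp_space_eq[OF \<nu>1(2)] by (simp add: cyl_def)
  \<comment> \<open>The real \<open>Inf\<close> and \<open>Sup\<close> of an empty family would
    carry no bounds; positive mass of the cylinder excludes this.\<close>
  have "C \<noteq> {}"
  proof
    assume "C = {}"
    then have "cyl = {}" by (simp add: cyl_def)
    with q \<open>0 < q\<close> show False by simp
  qed
  define a where "a u = measure (Pf j u) A" for u
  define b where "b u = measure (Pg j u) A" for u
  have bounds: "0 \<le> a u" "a u \<le> 1" "0 \<le> b u" "b u \<le> 1" if "u \<in> C" for u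
  proof -
    have u: "u \<in> space (PiM ?U ?D)" using that sets.sets_into_space[OF C] by auto
    show "0 \<le> a u" "a u \<le> 1" "0 \<le> b u" "b u \<le> 1"
      using prob_space.prob_le_1[OF F.prob_space_block_density[OF u]]
        prob_space.prob_le_1[OF G.prob_space_block_density[OF u]]
      by (simp_all add: a_def b_def Pf_def Pg_def F.post_pred_eq G.post_pred_eq)
  qed
  have extremal: "0 \<le> Inf (w ` C)" "Inf (w ` C) \<le> 1" "0 \<le> Sup (w ` C)" "Sup (w ` C) \<le> 1"
    "\<And>u. u \<in> C \<Longrightarrow> Inf (w ` C) \<le> w u" "\<And>u. u \<in> C \<Longrightarrow> w u \<le> Sup (w ` C)"
    if w: "\<forall>u\<in>C. 0 \<le> w u \<and> w u \<le> (1::real)" for w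
  proof -
    have bdd: "bdd_above (w ` C)" "bdd_below (w ` C)"
      using w by (auto intro!: bdd_aboveI2[where M = 1] bdd_belowI2[where m = 0])
    show lower: "Inf (w ` C) \<le> w u" and upper: "w u \<le> Sup (w ` C)" if "u \<in> C" for u
      using bdd that by (auto intro: cINF_lower cSUP_upper)
    show "0 \<le> Inf (w ` C)" "Sup (w ` C) \<le> 1"
      using \<open>C \<noteq> {}\<close> w by (auto intro: cINF_greatest cSUP_least)
    obtain u where "u \<in> C" using \<open>C \<noteq> {}\<close> by auto
    with lower upper w show "Inf (w ` C) \<le> 1" "0 \<le> Sup (w ` C)" by (meson order_trans)+
  qed
  have "\<forall>u\<in>C. 0 \<le> a u \<and> a u \<le> 1" "\<forall>u\<in>C. 0 \<le> b u \<and> b u \<le> 1"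
    using bounds by auto
  note ea = extremal[OF this(1)] and eb = extremal[OF this(2)]
  \<comment> \<open>Both laws being compared come out of a step \<open>j\<close>,
    \<open>\<nu>1\<close> by \<open>\<nu>1_eq\<close>, so uniform bounds on their predictive
    probabilities pass to \<open>rect\<close> relative to \<open>cyl\<close>.\<close>
  have F_ge: "c * measure \<nu>1 cyl \<le> measure \<nu>1 rect" if "0 \<le> c" "\<And>u. u \<in> C \<Longrightarrow> c \<le> a u" for c
    using F.measure_bind_kernel_rectangle_ge[OF \<nu>1 A C that(1)] that(2)
    by (simp add: \<nu>1_eq cyl_def rect_def a_def Pf_def F.post_pred_eq)
  have F_le: "measure \<nu>1 rect \<le> c * measure \<nu>1 cyl" if "0 \<le> c" "\<And>u. u \<in> C \<Longrightarrow> a u \<le> c" for c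
    using F.measure_bind_kernel_rectangle_le[OF \<nu>1 A C that(1)] that(2)
    by (simp add: \<nu>1_eq cyl_def rect_def a_def Pf_def F.post_pred_eq)
  let ?\<nu> = "law_after iterative j \<nu>2"
  have G_ge: "c * measure ?\<nu> cyl \<le> measure ?\<nu> rect" if "0 \<le> c" "\<And>u. u \<in> C \<Longrightarrow> c \<le> b u" for c
    using G.measure_bind_kernel_rectangle_ge[OF \<rho> A C that(1)] that(2)
    by (simp add: law_j cyl_def rect_def b_def Pg_def G.post_pred_eq)
  have G_le: "measure ?\<nu> rect \<le> c * measure ?\<nu> cyl" if "0 \<le> c" "\<And>u. u \<in> C \<Longrightarrow> b u \<le> c" for c
    using G.measure_bind_kernel_rectangle_le[OF \<rho> A C that(1)] that(2)
    by (simp add: law_j cyl_def rect_def b_def Pg_def G.post_pred_eq)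
  \<comment> \<open>If \<open>cyl\<close> does not separate the laws by the required amount,
    \<open>rect\<close> does.\<close>
  have "\<bar>measure ?\<nu> rect - measure \<nu>1 rect\<bar> > q * \<epsilon> / 4"
    if le: "\<bar>measure ?\<nu> cyl - measure \<nu>1 cyl\<bar> \<le> q * \<epsilon> / 4"
  proof -
    \<comment> \<open>Here \<open>a\<close> belongs to the Gibbs chain and \<open>b\<close> to the
      iterative one. The larger level in \<open>separated_rectangles\<close> is the infimum of
      \<open>b\<close> in the first case and of \<open>a\<close> in the second.\<close>
    consider "Sup (a ` C) + \<epsilon> < Inf (b ` C)" | "Sup (b ` C) + \<epsilon> < Inf (a ` C)"
      using assms(19) by (auto simp: a_def[abs_def] b_def[abs_def])
    then show ?thesis
    proof cases
      case 1
      then show ?thesis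
        using separated_rectangles[OF 1 eb(2) ea(4,3) \<open>0 < \<epsilon>\<close> \<open>0 < q\<close> q disjI1[OF conjI] le]
          G_ge[OF eb(1,5)] F_le[OF ea(3,6)] by blast
    next
      case 2
      then show ?thesis
        using separated_rectangles[OF 2 ea(2) eb(4,3) \<open>0 < \<epsilon>\<close> \<open>0 < q\<close> q disjI2[OF conjI] le]
          F_ge[OF ea(1,5)] G_le[OF eb(3,6)] by blast
    qed
  qed
  then show ?thesis using cyl_sets rect_sets by (meson not_less)
qed

end
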